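(* Every strongly normalising term $M\in\Lambda_{\circledR}$ is typeable in $\lambda_{\circledR}\cap$: there exist a basis $\Gamma$ and a strict type $\sigma$ such that $\Gamma\vdash M:\sigma$.
   Context: Terms. Fix a countably infinite set of variables. The set $\Lambda_{\circledR}$ of terms and the set $Fv(M)$ of free variables are defined simultaneously: every variable $x$ is a term with $Fv(x)=\{x\}$; $\lambda x.M$ is a term if $M$ is a term and $x\in Fv(M)$ (then $Fv=Fv(M)\setminus\{x\}$); $MN$ is a term if $M,N$ are terms and $Fv(M)\cap Fv(N)=\emptyset$ (then $Fv=Fv(M)\cup Fv(N)$); the erasure $x\odot M$ is a term if $M$ is a term and $x\notin Fv(M)$ (then $Fv=\{x\}\cup Fv(M)$); the duplication $x<^{x_1}_{x_2}M$ is a term if $M$ is a term, $x_1,x_2\in Fv(M)$, $x_1\ne x_2$, $x\notin Fv(M)\setminus\{x_1,x_2\}$ (then $Fv=\{x\}\cup(Fv(M)\setminus\{x_1,x_2\})$). $\lambda x$ binds $x$, the duplication binds $x_1,x_2$; terms are taken up to $\alpha$-conversion with Barendregt's variable convention. $Fv[M]$ is the ordered list of free variables (for $MN$: $Fv[M]$ followed by $Fv[N]$; for erasure/duplication the introduced $x$ is put first). For lists $X=[x_1,\dots,x_n]$, $Y,Z$ of equal length, $X\odot M$ abbreviates $x_1\odot\cdots x_n\odot M$ and $X<^{Y}_{Z}M$ abbreviates $x_1<^{y_1}_{z_1}\cdots x_n<^{y_n}_{z_n}M$ (both equal $M$ if $n=0$). Substitution. $M\langle N/x\rangle$ (for $M,N\in\Lambda_{\circledR}$,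 $x\in Fv(M)$, $(Fv(M)\setminus\{x\})\cap Fv(N)=\emptyset$) is the unique normal form, which lies in $\Lambda_{\circledR}$, of the explicit-substitution term $M[N/x]$ under the rewriting rules: $x[N/x]\to N$; $(\lambda y.M)[N/x]\to\lambda y.M[N/x]$ ($y\ne x$); $(MP)[N/x]\to M[N/x]P$ if $x\in Fv(M)$; $(MP)[N/x]\to M\,P[N/x]$ if $x\in Fv(P)$; $(y\odot M)[N/x]\to y\odot M[N/x]$ ($y\neq x$); $(x\odot M)[N/x]\to Fv(N)\odot M$; $(y<^{y_1}_{y_2}M)[N/x]\to y<^{y_1}_{y_2}M[N/x]$ ($y\ne x$); $(x<^{x_1}_{x_2}M)[N/x]\to Fv[N]<^{Fv[N_1]}_{Fv[N_2]}M[N_1/x_1][N_2/x_2]$, where $N_1,N_2$ are obtained from $N$ by renaming all its free variables to fresh variables. Reduction. $\rightarrow$ is the contextual closure, modulo structural equivalence, of: $(\lambda x.M)N\to M\langle N/x\rangle$; $x<^{x_1}_{x_2}(\lambda y.M)\to\lambda y.x<^{x_1}_{x_2}M$; $x<^{x_1}_{x_2}(MN)\to(x<^{x_1}_{x_2}M)N$ if $x_1,x_2\notin Fv(N)$; $x<^{x_1}_{x_2}(MN)\to M(x<^{x_1}_{x_2}N)$ if $x_1,x_2\notin Fv(M)$; $\lambda x.(y\odot M)\to y\odot(\lambda x.M)$ ($x\neq y$); $(x\odot M)N\to x\odot(MN)$; $M(x\odot N)\to x\odot(MN)$; $x<^{x_1}_{x_2}(y\odot M)\to y\odot(x<^{x_1}_{x_2}M)$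 ($y\ne x_1,x_2$); $x<^{x_1}_{x_2}(x_1\odot M)\to M\langle x/x_2\rangle$. Structural equivalence is the least equivalence closed under $\alpha$-conversion containing $x\odot(y\odot M)\equiv y\odot(x\odot M)$; $x<^{x_1}_{x_2}M\equiv x<^{x_2}_{x_1}M$; $x<^{y}_{z}(y<^{u}_{v}M)\equiv x<^{y}_{u}(y<^{z}_{v}M)$; $x<^{x_1}_{x_2}(y<^{y_1}_{y_2}M)\equiv y<^{y_1}_{y_2}(x<^{x_1}_{x_2}M)$ if $x\ne y_1,y_2$, $y\ne x_1,x_2$. A term is strongly normalising if it admits no infinite reduction sequence. Types. Strict types $\sigma::=p\mid\alpha\to\sigma$ ($p$ ranging over type atoms); types $\alpha::=\cap_{i=1}^n\sigma_i$, which is $\sigma_1\cap\dots\cap\sigma_n$ for $n>0$ and $\top$ for $n=0$; $\cap$ is commutative and associative with neutral element $\top$. A basis $\Gamma$ is a map from a finite set $Dom(\Gamma)$ of variables to types; $\Gamma,x:\alpha$ is its extension by $x\notin Dom(\Gamma)$; for $Dom(\Gamma)=Dom(\Delta)$, $(\Gamma\sqcap\Delta)(x)=\Gamma(x)\cap\Delta(x)$; $\Gamma^{\top}$ maps every variable of $Dom(\Gamma)$ to $\top$. The system $\lambda_{\circledR}\cap$ has rules: (Ax) $x:\sigma\vdash x:\sigma$; ($\to_I$) from $\Gamma,x:\alpha\vdash M:\sigma$ infer $\Gamma\vdash\lambda x.M:\alpha\to\sigma$; ($\to_E$) from $\Gamma\vdash M:\cap_{i=1}^n\tau_i\to\sigma$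 and $\Delta_0\vdash N:\tau_0,\dots,\Delta_n\vdash N:\tau_n$ infer $\Gamma,\Delta_0^{\top}\sqcap\Delta_1\sqcap\dots\sqcap\Delta_n\vdash MN:\sigma$; (Cont) from $\Gamma,x:\alpha,y:\beta\vdash M:\sigma$ infer $\Gamma,z:\alpha\cap\beta\vdash z<^{x}_{y}M:\sigma$; (Thin) from $\Gamma\vdash M:\sigma$ infer $\Gamma,x:\top\vdash x\odot M:\sigma$. *)

theory Defs
  imports "HOL-Library.Multiset"
begin

section \<open>Terms\<close>

text \<open>
  Raw terms, with variable names in binding positions. The constructor \<open>Sub M x N\<close> is the explicit
  substitution $M[N/x]$ (it binds \<open>x\<close> in \<open>M\<close>); it occurs only in the rewriting system that defines
  substitution and never in elements of \<open>LamR\<close> below. \<open>Era x M\<close> is the erasure $x \odot M$ and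
  \<open>Dup x x1 x2 M\<close> the duplication of \<open>x\<close> as \<open>x1\<close>, \<open>x2\<close> in \<open>M\<close>. The set function \<open>vars\<close> collects
  all names of a term, free and bound, and the map function \<open>rename\<close> acts on all of them.
\<close>

datatype (vars: 'v) tm =
    Var 'v
  | Lam 'v "'v tm"
  | App "'v tm" "'v tm"
  | Era 'v "'v tm"
  | Dup 'v 'v 'v "'v tm"
  | Sub "'v tm" 'v "'v tm"
  for map: rename

type_synonym var = nat
type_synonym trm = "var tm"

primrec Fv :: "trm \<Rightarrow> var set" where
  "Fv (Var x) = {x}"
| "Fv (Lam x M) = Fv M - {x}"
| "Fv (App M N) = Fv M \<union> Fv N"
| "Fv (Era x M) = {x} \<union> Fv M"
| "Fv (Dup x x1 x2 M) = {x} \<union> (Fv M - {x1, x2})"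
| "Fv (Sub M x N) = (Fv M - {x}) \<union> Fv N"

text \<open>The ordered list of free variables; on \<open>Sub\<close> its value is an irrelevant convention.\<close>

primrec fv_list :: "trm \<Rightarrow> var list" where
  "fv_list (Var x) = [x]"
| "fv_list (Lam x M) = removeAll x (fv_list M)"
| "fv_list (App M N) = fv_list M @ fv_list N"
| "fv_list (Era x M) = x # fv_list M"
| "fv_list (Dup x x1 x2 M) = x # removeAll x1 (removeAll x2 (fv_list M))"
| "fv_list (Sub M x N) = removeAll x (fv_list M) @ fv_list N"

inductive_set LamR :: "trm set" where
  Var: "Var x \<in> LamR"
| Lam: "M \<in> LamR \<Longrightarrow> x \<in> Fv M \<Longrightarrow> Lam x M \<in> LamR"
| App: "M \<in> LamR \<Longrightarrow> N \<in> LamR \<Longrightarrow> Fv M \<inter> Fv N = {} \<Longrightarrow> App M N \<in> LamR"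
| Era: "M \<in> LamR \<Longrightarrow> x \<notin> Fv M \<Longrightarrow> Era x M \<in> LamR"
| Dup: "M \<in> LamR \<Longrightarrow> x1 \<in> Fv M \<Longrightarrow> x2 \<in> Fv M \<Longrightarrow> x1 \<noteq> x2 \<Longrightarrow> x \<notin> Fv M - {x1, x2} \<Longrightarrow>
    Dup x x1 x2 M \<in> LamR"

definition eras :: "var list \<Rightarrow> trm \<Rightarrow> trm" where
  "eras X M = foldr Era X M"

definition dups :: "var list \<Rightarrow> var list \<Rightarrow> var list \<Rightarrow> trm \<Rightarrow> trm" where
  "dups X Y Z M = foldr (\<lambda>(x, y, z). Dup x y z) (zip X (zip Y Z)) M"


section \<open>Contextual closure, alpha-conversion, structural equivalence\<close>

inductive ctx :: "(trm \<Rightarrow> trm \<Rightarrow> bool) \<Rightarrow> trm \<Rightarrow> trm \<Rightarrow> bool" for R where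
  base: "R M N \<Longrightarrow> ctx R M N"
| Lam: "ctx R M N \<Longrightarrow> ctx R (Lam x M) (Lam x N)"
| AppL: "ctx R M N \<Longrightarrow> ctx R (App M P) (App N P)"
| AppR: "ctx R M N \<Longrightarrow> ctx R (App P M) (App P N)"
| Era: "ctx R M N \<Longrightarrow> ctx R (Era x M) (Era x N)"
| Dup: "ctx R M N \<Longrightarrow> ctx R (Dup x x1 x2 M) (Dup x x1 x2 N)"
| SubL: "ctx R M N \<Longrightarrow> ctx R (Sub M x P) (Sub N x P)"
| SubR: "ctx R M N \<Longrightarrow> ctx R (Sub P x M) (Sub P x N)"

text \<open>
  Renaming of one bound variable. The new name does not occur at all in the scope of the binder, so
  replacing every occurrence of the old name there (bound ones included) is harmless.
\<close>

inductive alpha1 :: "trm \<Rightarrow> trm \<Rightarrow> bool" where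
  "y \<notin> vars M \<Longrightarrow> alpha1 (Lam x M) (Lam y (rename (id(x := y)) M))"
| "y \<notin> vars M \<Longrightarrow> y \<noteq> x2 \<Longrightarrow> x1 \<noteq> x2 \<Longrightarrow>
    alpha1 (Dup x x1 x2 M) (Dup x y x2 (rename (id(x1 := y)) M))"
| "y \<notin> vars M \<Longrightarrow> y \<noteq> x1 \<Longrightarrow> x1 \<noteq> x2 \<Longrightarrow>
    alpha1 (Dup x x1 x2 M) (Dup x x1 y (rename (id(x2 := y)) M))"
| "y \<notin> vars M \<Longrightarrow> alpha1 (Sub M x N) (Sub (rename (id(x := y)) M) y N)"

definition alpha :: "trm \<Rightarrow> trm \<Rightarrow> bool" where
  "alpha = equivclp (ctx alpha1)"

text \<open>
  From here on, side conditions beyond those usually displayed spell out the variable convention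
  (bound names differ from each other and from the free names around them), which is not built
  into raw terms.
\<close>

inductive struct1 :: "trm \<Rightarrow> trm \<Rightarrow> bool" where
  "struct1 (Era x (Era y M)) (Era y (Era x M))"
| "struct1 (Dup x x1 x2 M) (Dup x x2 x1 M)"
| "distinct [y, z, u, v] \<Longrightarrow> struct1 (Dup x y z (Dup y u v M)) (Dup x y u (Dup y z v M))"
| "x \<noteq> y1 \<Longrightarrow> x \<noteq> y2 \<Longrightarrow> y \<noteq> x1 \<Longrightarrow> y \<noteq> x2 \<Longrightarrow>
    struct1 (Dup x x1 x2 (Dup y y1 y2 M)) (Dup y y1 y2 (Dup x x1 x2 M))"

text \<open>
  The axioms apply to subterms, so that reduction is well defined on equivalence classes.
\<close>

definition struct_eq :: "trm \<Rightarrow> trm \<Rightarrow> bool" where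
  "struct_eq = equivclp (ctx (\<lambda>M N. alpha1 M N \<or> struct1 M N))"


section \<open>Substitution\<close>

definition fresh_renaming :: "(var \<Rightarrow> var) \<Rightarrow> trm \<Rightarrow> var set \<Rightarrow> bool" where
  "fresh_renaming f N A \<longleftrightarrow>
     inj_on f (Fv N) \<and> f ` Fv N \<inter> A = {} \<and> (\<forall>v. v \<notin> Fv N \<longrightarrow> f v = v)"

inductive esub1 :: "trm \<Rightarrow> trm \<Rightarrow> bool" where
  "esub1 (Sub (Var x) x N) N"
| "y \<noteq> x \<Longrightarrow> y \<notin> Fv N \<Longrightarrow> esub1 (Sub (Lam y M) x N) (Lam y (Sub M x N))"
| "x \<in> Fv M \<Longrightarrow> esub1 (Sub (App M P) x N) (App (Sub M x N) P)"
| "x \<in> Fv P \<Longrightarrow> esub1 (Sub (App M P) x N) (App M (Sub P x N))"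
| "y \<noteq> x \<Longrightarrow> esub1 (Sub (Era y M) x N) (Era y (Sub M x N))"
| "esub1 (Sub (Era x M) x N) (eras (fv_list N) M)"
| "y \<noteq> x \<Longrightarrow> x \<notin> {y1, y2} \<Longrightarrow> y1 \<notin> Fv N \<Longrightarrow> y2 \<notin> Fv N \<Longrightarrow>
    esub1 (Sub (Dup y y1 y2 M) x N) (Dup y y1 y2 (Sub M x N))"
| "fresh_renaming f1 N (vars M \<union> vars N \<union> {x, x1, x2}) \<Longrightarrow>
   fresh_renaming f2 N (vars M \<union> vars N \<union> {x, x1, x2} \<union> f1 ` Fv N) \<Longrightarrow>
   N1 = rename f1 N \<Longrightarrow> N2 = rename f2 N \<Longrightarrow>
   esub1 (Sub (Dup x x1 x2 M) x N)
         (dups (fv_list N) (fv_list N1) (fv_list N2) (Sub (Sub M x1 N1) x2 N2))"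

text \<open>One rewriting step on terms with explicit substitutions, up to alpha-conversion.\<close>

definition esub :: "trm \<Rightarrow> trm \<Rightarrow> bool" where
  "esub = alpha OO ctx esub1 OO alpha"

text \<open>
  \<open>subst M N x P\<close> says that \<open>P\<close> is (a representative of) $M\langle N/x\rangle$.
\<close>

definition subst :: "trm \<Rightarrow> trm \<Rightarrow> var \<Rightarrow> trm \<Rightarrow> bool" where
  "subst M N x P \<longleftrightarrow>
     M \<in> LamR \<and> N \<in> LamR \<and> x \<in> Fv M \<and> (Fv M - {x}) \<inter> Fv N = {} \<and>
     esub\<^sup>*\<^sup>* (Sub M x N) P \<and> (\<nexists>Q. esub P Q) \<and> P \<in> LamR"


section \<open>Reduction\<close>

inductive red1 :: "trm \<Rightarrow> trm \<Rightarrow> bool" where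
  beta: "subst M N x P \<Longrightarrow> red1 (App (Lam x M) N) P"
| gamma1: "y \<notin> {x, x1, x2} \<Longrightarrow> red1 (Dup x x1 x2 (Lam y M)) (Lam y (Dup x x1 x2 M))"
| gamma2: "x1 \<notin> Fv N \<Longrightarrow> x2 \<notin> Fv N \<Longrightarrow>
    red1 (Dup x x1 x2 (App M N)) (App (Dup x x1 x2 M) N)"
| gamma3: "x1 \<notin> Fv M \<Longrightarrow> x2 \<notin> Fv M \<Longrightarrow>
    red1 (Dup x x1 x2 (App M N)) (App M (Dup x x1 x2 N))"
| omega1: "x \<noteq> y \<Longrightarrow> red1 (Lam x (Era y M)) (Era y (Lam x M))"
| omega2: "red1 (App (Era x M) N) (Era x (App M N))"
| omega3: "red1 (App M (Era x N)) (Era x (App M N))"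
| gammaomega1: "y \<noteq> x1 \<Longrightarrow> y \<noteq> x2 \<Longrightarrow>
    red1 (Dup x x1 x2 (Era y M)) (Era y (Dup x x1 x2 M))"
| gammaomega2: "subst M (Var x) x2 P \<Longrightarrow> red1 (Dup x x1 x2 (Era x1 M)) P"

definition red :: "trm \<Rightarrow> trm \<Rightarrow> bool" where
  "red = struct_eq OO ctx red1 OO struct_eq"

definition strongly_normalising :: "trm \<Rightarrow> bool" where
  "strongly_normalising M \<longleftrightarrow> \<not> (\<exists>f :: nat \<Rightarrow> trm. f 0 = M \<and> (\<forall>i. red (f i) (f (Suc i))))"


section \<open>Types\<close>

text \<open>
  Intersections taken up to commutativity, associativity and neutrality of $\top$ (and not up to
  idempotence) are exactly finite multisets of strict types: $\cap$ is \<open>+\<close>, $\top$ is \<open>{#}\<close>, and a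
  strict type \<open>\<sigma>\<close> used as a type is \<open>{#\<sigma>#}\<close>. The parameter \<open>'p\<close> is the type of type atoms.
\<close>

datatype 'p sty = Atom 'p | Arr "'p sty multiset" "'p sty"

type_synonym 'p ty = "'p sty multiset"
type_synonym 'p basis = "var \<rightharpoonup> 'p ty"

text \<open>Only used for bases with equal domains.\<close>

definition meet :: "'p basis \<Rightarrow> 'p basis \<Rightarrow> 'p basis" where
  "meet \<Gamma> \<Delta> = (\<lambda>x. case (\<Gamma> x, \<Delta> x) of (Some \<alpha>, Some \<beta>) \<Rightarrow> Some (\<alpha> + \<beta>) | _ \<Rightarrow> None)"

definition top_basis :: "'p basis \<Rightarrow> 'p basis" where
  "top_basis \<Gamma> = (\<lambda>x. map_option (\<lambda>_. {#}) (\<Gamma> x))"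

inductive typing :: "'p basis \<Rightarrow> trm \<Rightarrow> 'p sty \<Rightarrow> bool" where
  Ax: "typing [x \<mapsto> {#\<sigma>#}] (Var x) \<sigma>"
| ArrI: "x \<notin> dom \<Gamma> \<Longrightarrow> typing (\<Gamma>(x \<mapsto> \<alpha>)) M \<sigma> \<Longrightarrow> typing \<Gamma> (Lam x M) (Arr \<alpha> \<sigma>)"
| ArrE: "typing \<Gamma> M (Arr (mset \<tau>s) \<sigma>) \<Longrightarrow>
    typing \<Delta>0 N \<tau>0 \<Longrightarrow>
    length \<Delta>s = length \<tau>s \<Longrightarrow>
    (\<forall>i < length \<tau>s. typing (\<Delta>s ! i) N (\<tau>s ! i)) \<Longrightarrow>
    (\<forall>\<Delta> \<in> set \<Delta>s. dom \<Delta> = dom \<Delta>0) \<Longrightarrow>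
    dom \<Gamma> \<inter> dom \<Delta>0 = {} \<Longrightarrow>
    typing (\<Gamma> ++ foldl meet (top_basis \<Delta>0) \<Delta>s) (App M N) \<sigma>"
| Cont: "x \<notin> dom \<Gamma> \<Longrightarrow> y \<notin> dom \<Gamma> \<Longrightarrow> x \<noteq> y \<Longrightarrow> z \<notin> dom \<Gamma> \<Longrightarrow>
    typing (\<Gamma>(x \<mapsto> \<alpha>, y \<mapsto> \<beta>)) M \<sigma> \<Longrightarrow>
    typing (\<Gamma>(z \<mapsto> \<alpha> + \<beta>)) (Dup z x y M) \<sigma>"
| Thin: "x \<notin> dom \<Gamma> \<Longrightarrow> typing \<Gamma> M \<sigma> \<Longrightarrow> typing (\<Gamma>(x \<mapsto> {#})) (Era x M) \<sigma>"

end

theory Submission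
  imports Defs "HOL-Library.Function_Algebras"
begin

text \<open>
  Erasures, duplications and abstractions are typeable as soon as their body is, so only
  applications need work. The head of an application is reached through applications and
  duplications. If it is a variable, the term can be given every type, provided its arguments are
  typeable. Otherwise an abstraction or an erasure meets an application or a duplication, which
  yields a reduction step; typings are pulled back along this step, a beta-step using that the
  (possibly erased) argument is typeable. So it suffices to induct on reduction and on subterms.

  Existence of substitution is proved by induction on the number of duplications met, then on size:
  substituting for one of the two copies of a duplicated variable does not change the number of
  duplications met by the other copy.
\<close>

section \<open>Renaming\<close>

text \<open>Two features of the system shape the proof. Rule \<open>ArrE\<close> asks for a typing
  of the argument even when the function has type \<open>Arr {#} \<sigma>\<close>. Pulling a typing
  back along a beta-step that erases its argument therefore needs a typing of that argument from
  elsewhere, and the induction on subterms supplies it. Substitution is given only as a normal form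
  of a rewriting system modulo alpha-conversion. One rewriting sequence is constructed for each
  substitution, and \<open>is_subst\<close> records what holds at its end: the free variables, the
  duplication counts of the other variables, and a splitting of every typing of the result into a
  typing of the body and one typing of \<open>N\<close> for each element of the type of
  \<open>x\<close>. Intersections are multisets, so this splitting is exact and the bases simply add
  up. A reduct of the term under study may be larger than the term. The induction therefore follows
  an accessible term that contains it: a reduct of a subterm is a subterm of a reduct.\<close>

lemma Fv_subset_vars: "Fv M \<subseteq> vars M"
  by (induction M) auto

lemma finite_vars: "finite (vars M)"
  by (induction M) auto

lemma finite_Fv: "finite (Fv M)"
  using Fv_subset_vars finite_vars by (rule finite_subset)

lemma set_fv_list: "set (fv_list M) = Fv M"
  by (induction M) auto

lemma distinct_fv_list: "M \<in> LamR \<Longrightarrow> distinct (fv_list M)"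
  by (induction rule: LamR.induct) (auto simp: set_fv_list distinct_removeAll)

lemma LamR_iff:
  "Lam x M \<in> LamR \<longleftrightarrow> M \<in> LamR \<and> x \<in> Fv M"
  "App M N \<in> LamR \<longleftrightarrow> M \<in> LamR \<and> N \<in> LamR \<and> Fv M \<inter> Fv N = {}"
  "Era x M \<in> LamR \<longleftrightarrow> M \<in> LamR \<and> x \<notin> Fv M"
  "Dup x x1 x2 M \<in> LamR \<longleftrightarrow>
     M \<in> LamR \<and> x1 \<in> Fv M \<and> x2 \<in> Fv M \<and> x1 \<noteq> x2 \<and> x \<notin> Fv M - {x1, x2}"
  "Sub M x N \<notin> LamR"
  by (auto elim: LamR.cases intro: LamR.intros)

text \<open>\<open>rename\<close> acts on bound names too, so only injective maps commute with the
  binders. Involutions are moreover their own inverses, so one inclusion or implication gives both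
  directions.\<close>

definition involution :: "(var \<Rightarrow> var) \<Rightarrow> bool" where
  "involution \<pi> \<longleftrightarrow> (\<forall>v. \<pi> (\<pi> v) = v)"

lemma involution_apply: "involution \<pi> \<Longrightarrow> \<pi> (\<pi> v) = v"
  by (simp add: involution_def)

lemma involution_eq_iff: "involution \<pi> \<Longrightarrow> \<pi> u = \<pi> v \<longleftrightarrow> u = v"
  by (metis involution_def)

lemma involution_inj: "involution \<pi> \<Longrightarrow> inj \<pi>"
  by (simp add: inj_def involution_eq_iff)

lemma rename_involution: "involution \<pi> \<Longrightarrow> rename \<pi> (rename \<pi> M) = M"
  by (simp add: tm.map_comp comp_def involution_def tm.map_ident)

lemma Fv_rename: "involution \<pi> \<Longrightarrow> Fv (rename \<pi> M) = \<pi> ` Fv M"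
  by (induction M) (auto simp: image_set_diff involution_inj image_Un)

lemma mem_image_involution: "involution \<pi> \<Longrightarrow> v \<in> \<pi> ` A \<longleftrightarrow> \<pi> v \<in> A"
  by (metis image_iff involution_def)

lemma fv_list_rename: "involution \<pi> \<Longrightarrow> fv_list (rename \<pi> M) = map \<pi> (fv_list M)"
proof (induction M)
  case (Lam x M)
  then show ?case
    by (simp add: removeAll_filter_not_eq filter_map comp_def involution_eq_iff)
next
  case (Dup x x1 x2 M)
  then show ?case
    by (simp add: removeAll_filter_not_eq filter_map comp_def involution_eq_iff)
next
  case (Sub M x N)
  then show ?case
    by (simp add: removeAll_filter_not_eq filter_map comp_def involution_eq_iff)
qed simp_all

lemma rename_LamR:
  assumes "involution \<pi>"
  shows "M \<in> LamR \<Longrightarrow> rename \<pi> M \<in> LamR"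
  by (induction rule: LamR.induct)
     (auto intro!: LamR.intros
       simp: Fv_rename assms mem_image_involution involution_apply involution_eq_iff)

lemma size_rename: "size (rename f M) = size M"
  by (induction M) auto

definition swap :: "var \<Rightarrow> var \<Rightarrow> var \<Rightarrow> var" where
  "swap x y v = (if v = x then y else if v = y then x else v)"

lemma involution_swap: "involution (swap x y)"
  by (simp add: involution_def swap_def)

text \<open>Replacing \<open>x\<close> by \<open>y\<close> is not injective on all names, but on the
  names of \<open>M\<close> it agrees with an involution. This makes the results on involutions
  available for \<open>alpha1\<close>.\<close>

lemma rename_eq_swap: "y \<notin> vars M \<Longrightarrow> rename (id(x := y)) M = rename (swap x y) M"
  by (rule tm.map_cong0) (auto simp: swap_def)

text \<open>The number of duplications that a substitution for the free variable \<open>x\<close> meets.\<close>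

primrec dup_count :: "trm \<Rightarrow> var \<Rightarrow> nat" where
  "dup_count (Var y) x = 0"
| "dup_count (Lam y M) x = (if x = y then 0 else dup_count M x)"
| "dup_count (App M N) x = dup_count M x + dup_count N x"
| "dup_count (Era y M) x = dup_count M x"
| "dup_count (Dup y y1 y2 M) x =
    (if x = y then Suc (dup_count M y1 + dup_count M y2)
     else if x \<in> {y1, y2} then 0 else dup_count M x)"
| "dup_count (Sub M y N) x = 0"

lemma dup_count_notin: "x \<notin> Fv M \<Longrightarrow> dup_count M x = 0"
  by (induction M arbitrary: x) auto

lemma dup_count_rename:
  assumes "involution \<pi>"
  shows "dup_count (rename \<pi> M) x = dup_count M (\<pi> x)"
proof -
  have eq: "x = \<pi> y \<longleftrightarrow> \<pi> x = y" for x y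
    using assms involution_apply by metis
  show ?thesis
    by (induction M arbitrary: x) (simp_all add: eq involution_apply[OF assms])
qed

section \<open>Typing with total bases\<close>

type_synonym 'p env = "var \<Rightarrow> 'p ty"

text \<open>This is the family of typings of an argument in \<open>ArrE\<close>: one basis for each
  element of the intersection, all bases added. The relation is a parameter so that
  \<open>ty\<close> can be nested inside it.\<close>

inductive msum :: "('p env \<Rightarrow> 'p sty \<Rightarrow> bool) \<Rightarrow> 'p env \<Rightarrow> 'p ty \<Rightarrow> bool" for R where
  empty: "msum R 0 {#}"
| add: "R G \<tau> \<Longrightarrow> msum R H \<alpha> \<Longrightarrow> msum R (G + H) (add_mset \<tau> \<alpha>)"

lemma msum_mono: "R \<le> S \<Longrightarrow> msum R \<le> msum S"
proof (intro predicate2I)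
  fix H \<alpha> assume "R \<le> S" "msum R H \<alpha>"
  from this(2,1) show "msum S H \<alpha>"
    by (induction rule: msum.induct) (auto intro: msum.intros)
qed

text \<open>Needed for the inductive definition of \<open>ty\<close>, whose application rule has a
  premise inside \<open>msum\<close>.\<close>

lemma msum_mono' [mono]:
  "(\<And>G \<tau>. R G \<tau> \<longrightarrow> S G \<tau>) \<Longrightarrow> msum R H \<alpha> \<longrightarrow> msum S H \<alpha>"
  using msum_mono[of R S] by (auto simp: le_fun_def)

lemma msum_plus: "msum R H \<alpha> \<Longrightarrow> msum R K \<beta> \<Longrightarrow> msum R (H + K) (\<alpha> + \<beta>)"
  by (induction rule: msum.induct) (auto simp: add.assoc intro: msum.intros)

text \<open>
  Bases are total functions here, with value \<open>{#}\<close> outside the free variables; this turns the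
  combination of bases into pointwise addition.
\<close>

inductive ty :: "'p env \<Rightarrow> trm \<Rightarrow> 'p sty \<Rightarrow> bool" where
  Var: "ty (0(x := {#\<sigma>#})) (Var x) \<sigma>"
| Lam: "ty G M \<sigma> \<Longrightarrow> ty (G(x := {#})) (Lam x M) (Arr (G x) \<sigma>)"
| App: "ty G M (Arr \<alpha> \<sigma>) \<Longrightarrow> msum (\<lambda>H \<tau>. ty H N \<tau>) H \<alpha> \<Longrightarrow> ty H0 N \<tau>0 \<Longrightarrow>
    ty (G + H) (App M N) \<sigma>"
| Era: "ty G M \<sigma> \<Longrightarrow> ty G (Era x M) \<sigma>"
| Dup: "ty G M \<sigma> \<Longrightarrow> ty (G(x1 := {#}, x2 := {#}, x := G x1 + G x2)) (Dup x x1 x2 M) \<sigma>"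

inductive_cases ty_VarE: "ty G (Var x) \<sigma>"
inductive_cases ty_LamE: "ty G (Lam x M) \<sigma>"
inductive_cases ty_AppE: "ty G (App M N) \<sigma>"
inductive_cases ty_EraE: "ty G (Era x M) \<sigma>"
inductive_cases ty_DupE: "ty G (Dup x x1 x2 M) \<sigma>"

lemma msum_support: "msum R H \<alpha> \<Longrightarrow> (\<And>G \<tau>. R G \<tau> \<Longrightarrow> G v = {#}) \<Longrightarrow> H v = {#}"
  by (induction rule: msum.induct) auto

text \<open>Stands in for the domain conditions of \<open>typing\<close>: it decides which summand
  of a sum of bases contributes at a given variable.\<close>

lemma ty_support: "ty G M \<sigma> \<Longrightarrow> v \<notin> Fv M \<Longrightarrow> G v = {#}"
proof (induction arbitrary: v rule: ty.induct)
  case (App G M \<alpha> \<sigma> N H H0 \<tau>0)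
  have "H v = {#}"
    using App.IH(2) by (rule msum_support) (use App.prems in auto)
  with App show ?case by auto
qed auto

lemma msum_ty_support: "msum (\<lambda>H \<tau>. ty H N \<tau>) H \<alpha> \<Longrightarrow> v \<notin> Fv N \<Longrightarrow> H v = {#}"
  by (erule msum_support) (rule ty_support)

lemma msum_map:
  fixes f :: "var \<Rightarrow> var"
  shows "msum R H \<alpha> \<Longrightarrow> (\<And>G \<tau>. R G \<tau> \<Longrightarrow> S (G \<circ> f) \<tau>) \<Longrightarrow> msum S (H \<circ> f) \<alpha>"
proof (induction rule: msum.induct)
  case empty
  have eq: "(0::'a env) \<circ> f = 0" by auto
  show ?case unfolding eq by (rule msum.empty)
next
  case (add G \<tau> H \<alpha>)
  have eq: "(G + H) \<circ> f = (G \<circ> f) + (H \<circ> f)" by auto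
  show ?case unfolding eq by (rule msum.add) (use add in blast)+
qed

text \<open>The basis has to be composed with the inverse of the renaming, which is
  \<open>\<pi>\<close> itself.\<close>

lemma ty_rename:
  assumes \<pi>: "involution \<pi>"
  shows "ty G M \<sigma> \<Longrightarrow> ty (G \<circ> \<pi>) (rename \<pi> M) \<sigma>"
proof (induction rule: ty.induct)
  case (Var x \<sigma>)
  have eq: "(0(x := {#\<sigma>#})) \<circ> \<pi> = 0(\<pi> x := {#\<sigma>#})"
    using \<pi> by (auto simp: fun_eq_iff involution_apply)
  show ?case unfolding eq tm.map by (rule ty.Var)
next
  case (Lam G M \<sigma> x)
  have eq: "G(x := {#}) \<circ> \<pi> = (G \<circ> \<pi>)(\<pi> x := {#})" "G x = (G \<circ> \<pi>) (\<pi> x)"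
    using \<pi> by (auto simp: fun_eq_iff involution_apply)
  show ?case unfolding eq tm.map by (rule ty.Lam) (rule Lam.IH)
next
  case (App G M \<alpha> \<sigma> N H H0 \<tau>0)
  have "msum (\<lambda>H \<tau>. ty H (rename \<pi> N) \<tau>) (H \<circ> \<pi>) \<alpha>"
    using App.IH(2) by (rule msum_map) blast
  moreover have eq: "(G + H) \<circ> \<pi> = (G \<circ> \<pi>) + (H \<circ> \<pi>)" by auto
  ultimately show ?case unfolding eq tm.map using App.IH by (blast intro: ty.App)
next
  case (Dup G M \<sigma> x1 x2 x)
  have eq: "G(x1 := {#}, x2 := {#}, x := G x1 + G x2) \<circ> \<pi> =
     (G \<circ> \<pi>)(\<pi> x1 := {#}, \<pi> x2 := {#}, \<pi> x := (G \<circ> \<pi>) (\<pi> x1) + (G \<circ> \<pi>) (\<pi> x2))"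
    using \<pi> by (auto simp: fun_eq_iff involution_apply)
  show ?case unfolding eq tm.map by (rule ty.Dup) (rule Dup.IH)
qed (auto intro: ty.intros)

lemma ty_rename_iff:
  assumes "involution \<pi>"
  shows "ty G (rename \<pi> M) \<sigma> \<longleftrightarrow> ty (G \<circ> \<pi>) M \<sigma>"
proof -
  have "G \<circ> \<pi> \<circ> \<pi> = G" using assms by (auto simp: involution_apply)
  then show ?thesis
    using ty_rename[OF assms, of G "rename \<pi> M" \<sigma>] ty_rename[OF assms, of "G \<circ> \<pi>" M \<sigma>]
    by (auto simp: rename_involution assms)
qed

section \<open>From total bases to bases with finite domain\<close>

definition to_basis :: "var set \<Rightarrow> 'p env \<Rightarrow> 'p basis" where
  "to_basis A G = (\<lambda>v. if v \<in> A then Some (G v) else None)"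

lemma dom_to_basis: "dom (to_basis A G) = A"
  by (auto simp: to_basis_def split: if_splits)

text \<open>Enumerates the family in some order, since \<open>ArrE\<close> takes its premises as
  lists.\<close>

lemma msum_lists:
  "msum R H \<alpha> \<Longrightarrow> \<exists>Gs \<tau>s. length Gs = length \<tau>s \<and> \<alpha> = mset \<tau>s \<and> H = sum_list Gs \<and>
     (\<forall>i < length \<tau>s. R (Gs ! i) (\<tau>s ! i))"
proof (induction rule: msum.induct)
  case empty
  show ?case by (rule exI[of _ "[]"], rule exI[of _ "[]"]) simp
next
  case (add G \<tau> H \<alpha>)
  then obtain Gs \<tau>s where "length Gs = length \<tau>s" "\<alpha> = mset \<tau>s" "H = sum_list Gs"
    "\<forall>i < length \<tau>s. R (Gs ! i) (\<tau>s ! i)" by blast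
  with add(1) show ?case
    by (intro exI[of _ "G # Gs"] exI[of _ "\<tau> # \<tau>s"]) (auto simp: nth_Cons split: nat.splits)
qed

lemma foldl_meet_to_basis:
  "foldl meet (to_basis A G) (map (to_basis A) Gs) = to_basis A (G + sum_list Gs)"
proof (induction Gs arbitrary: G)
  case (Cons H Gs)
  have "meet (to_basis A G) (to_basis A H) = to_basis A (G + H)"
    by (auto simp: meet_def to_basis_def)
  with Cons[of "G + H"] show ?case by (simp only: list.map foldl_Cons sum_list.Cons add.assoc)
qed simp

text \<open>A total basis is cut down to the free variables. The linearity conditions of
  \<open>LamR\<close> then discharge the freshness and disjointness conditions of the typing
  rules.\<close>

lemma ty_imp_typing:
  fixes G :: "'p env"
  shows "M \<in> LamR \<Longrightarrow> ty G M \<sigma> \<Longrightarrow> typing (to_basis (Fv M) G) M \<sigma>"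
proof (induction arbitrary: G \<sigma> rule: LamR.induct)
  case (Var x)
  then have "G = 0(x := {#\<sigma>#})" by (auto elim: ty_VarE)
  then have eq: "to_basis (Fv (Var x)) G = [x \<mapsto> {#\<sigma>#}]" by (auto simp: to_basis_def)
  show ?case unfolding eq by (rule typing.Ax)
next
  case (Lam M x)
  from Lam.prems obtain G' \<tau> where G': "G = G'(x := {#})" "\<sigma> = Arr (G' x) \<tau>" "ty G' M \<tau>"
    by (auto elim: ty_LamE)
  have eq: "to_basis (Fv M) G' = (to_basis (Fv (Lam x M)) G)(x \<mapsto> G' x)"
    using Lam.hyps G' by (auto simp: to_basis_def fun_eq_iff)
  show ?case unfolding G'(2)
    by (rule typing.ArrI) (use Lam.IH[OF G'(3)] in \<open>simp_all only: eq\<close>, simp add: dom_to_basis)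
next
  case (App M N)
  from App.prems obtain G1 \<alpha> H \<tau>0 and H0 :: "'p env" where G: "G = G1 + H" "ty G1 M (Arr \<alpha> \<sigma>)"
    "msum (\<lambda>H \<tau>. ty H N \<tau>) H \<alpha>" "ty H0 N \<tau>0" by (auto elim: ty_AppE)
  obtain Gs \<tau>s where Gs: "length Gs = length \<tau>s" "\<alpha> = mset \<tau>s" "H = sum_list Gs"
    "\<forall>i < length \<tau>s. ty (Gs ! i) N (\<tau>s ! i)" using msum_lists[OF G(3)] by blast
  let ?\<Delta>s = "map (to_basis (Fv N)) Gs"
  have "typing (to_basis (Fv M) G1 ++ foldl meet (top_basis (to_basis (Fv N) H0)) ?\<Delta>s) (App M N) \<sigma>"
    using App.IH G Gs App.hyps by (intro typing.ArrE[where \<tau>s=\<tau>s]) (auto simp: dom_to_basis)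
  \<comment> \<open>The additional premise contributes the zero basis, so folding
    \<open>meet\<close> leaves exactly the sum \<open>H\<close>.\<close>
  moreover have "top_basis (to_basis (Fv N) H0) = to_basis (Fv N) 0"
    by (auto simp: top_basis_def to_basis_def)
  \<comment> \<open>The domains are disjoint and each summand vanishes outside its own domain, so
    overriding and adding coincide.\<close>
  moreover have "to_basis (Fv M) G1 ++ to_basis (Fv N) H = to_basis (Fv (App M N)) G"
  proof
    fix v
    show "(to_basis (Fv M) G1 ++ to_basis (Fv N) H) v = to_basis (Fv (App M N)) G v"
      using App.hyps ty_support[OF G(2), of v] msum_ty_support[OF G(3), of v]
      by (auto simp: to_basis_def G(1) map_add_def)
  qed
  ultimately show ?case using foldl_meet_to_basis[of "Fv N" 0 Gs] Gs(3) by simp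
next
  case (Era M x)
  then have G: "ty G M \<sigma>" by (auto elim: ty_EraE)
  \<comment> \<open>As \<open>x\<close> is not free in \<open>M\<close>, its value in
    \<open>G\<close> is already the top type that \<open>Thin\<close> introduces.\<close>
  have eq: "to_basis (Fv (Era x M)) G = (to_basis (Fv M) G)(x \<mapsto> {#})"
    using Era.hyps ty_support[OF G, of x] by (auto simp: to_basis_def)
  show ?case unfolding eq by (rule typing.Thin) (use Era.IH[OF G] Era.hyps in \<open>simp_all add: dom_to_basis\<close>)
next
  case (Dup M x1 x2 x)
  from Dup.prems obtain G' where G': "G = G'(x1 := {#}, x2 := {#}, x := G' x1 + G' x2)" "ty G' M \<sigma>"
    by (auto elim: ty_DupE)
  \<comment> \<open>The introduced \<open>x\<close> may coincide with \<open>x1\<close> or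
    \<open>x2\<close>. Hence both are removed from the domain first, and \<open>x\<close> is updated
    last.\<close>
  let ?\<Gamma> = "to_basis (Fv M - {x1, x2}) G'"
  have 1: "to_basis (Fv M) G' = ?\<Gamma>(x1 \<mapsto> G' x1, x2 \<mapsto> G' x2)"
    using Dup.hyps by (auto simp: to_basis_def fun_eq_iff)
  have 2: "to_basis (Fv (Dup x x1 x2 M)) G = ?\<Gamma>(x \<mapsto> G' x1 + G' x2)"
    using Dup.hyps G' by (auto simp: to_basis_def fun_eq_iff)
  show ?case unfolding 2
    by (rule typing.Cont[OF _ _ _ _ Dup.IH[OF G'(2), unfolded 1]])
       (use Dup.hyps in \<open>auto simp: dom_to_basis\<close>)
qed

section \<open>Alpha-conversion\<close>

text \<open>The renamings of single names become swaps, because the new name is fresh for the scope.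
  The remaining rule of \<open>alpha1\<close> concerns explicit substitutions only, which lie
  outside \<open>LamR\<close>.\<close>

lemma alpha1_LamR_cases:
  assumes "alpha1 M N"
  obtains (Lam) x y M' where "M = Lam x M'" "y \<notin> vars M'" "N = Lam y (rename (swap x y) M')"
  | (Dup1) x x1 x2 y M' where "M = Dup x x1 x2 M'" "y \<notin> vars M'" "y \<noteq> x2" "x1 \<noteq> x2"
      "N = Dup x y x2 (rename (swap x1 y) M')"
  | (Dup2) x x1 x2 y M' where "M = Dup x x1 x2 M'" "y \<notin> vars M'" "y \<noteq> x1" "x1 \<noteq> x2"
      "N = Dup x x1 y (rename (swap x2 y) M')"
  | (Sub) "M \<notin> LamR"
  using assms
  by (cases rule: alpha1.cases) (auto simp: rename_eq_swap LamR_iff)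

lemma Fv_rename_swap: "v \<in> Fv (rename (swap x y) M) \<longleftrightarrow> swap x y v \<in> Fv M"
  by (simp add: Fv_rename mem_image_involution involution_swap)

lemma notin_vars_notin_Fv: "x \<notin> vars M \<Longrightarrow> x \<notin> Fv M"
  using Fv_subset_vars by blast

lemma alpha1_Fv: "alpha1 M N \<Longrightarrow> M \<in> LamR \<Longrightarrow> Fv N = Fv M"
  by (erule alpha1_LamR_cases)
     (auto simp: Fv_rename_swap swap_def notin_vars_notin_Fv split: if_splits)

lemma alpha1_LamR: "alpha1 M N \<Longrightarrow> M \<in> LamR \<Longrightarrow> N \<in> LamR"
proof (frule (1) alpha1_Fv, erule alpha1_LamR_cases)
  fix x y M' assume "M \<in> LamR" "M = Lam x M'" "y \<notin> vars M'" "N = Lam y (rename (swap x y) M')"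
  moreover from this have "M' \<in> LamR" "x \<in> Fv M'" by (auto simp: LamR_iff)
  ultimately show "N \<in> LamR"
    by (auto intro!: LamR.intros rename_LamR involution_swap simp: Fv_rename_swap swap_def split: if_splits)
next
  fix x x1 x2 y M' assume *: "M \<in> LamR" "M = Dup x x1 x2 M'" "y \<notin> vars M'" "y \<noteq> x2" "x1 \<noteq> x2"
    "N = Dup x y x2 (rename (swap x1 y) M')"
  then have "M' \<in> LamR" "x1 \<in> Fv M'" "x2 \<in> Fv M'" "x \<notin> Fv M' - {x1, x2}"
    by (auto simp: LamR_iff)
  with * show "N \<in> LamR"
    using Fv_subset_vars[of M']
    by (auto intro!: LamR.intros rename_LamR involution_swap simp: Fv_rename_swap swap_def split: if_splits)
next
  fix x x1 x2 y M' assume *: "M \<in> LamR" "M = Dup x x1 x2 M'" "y \<notin> vars M'" "y \<noteq> x1" "x1 \<noteq> x2"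
    "N = Dup x x1 y (rename (swap x2 y) M')"
  then have "M' \<in> LamR" "x1 \<in> Fv M'" "x2 \<in> Fv M'" "x \<notin> Fv M' - {x1, x2}"
    by (auto simp: LamR_iff)
  with * show "N \<in> LamR"
    using Fv_subset_vars[of M']
    by (auto intro!: LamR.intros rename_LamR involution_swap simp: Fv_rename_swap swap_def split: if_splits)
qed auto

lemma alpha1_size: "alpha1 M N \<Longrightarrow> size N = size M"
  by (cases rule: alpha1.cases) (auto simp: size_rename)

lemma dup_count_rename_swap: "dup_count (rename (swap x y) M) v = dup_count M (swap x y v)"
  by (simp add: dup_count_rename involution_swap)

lemma dup_count_notin_vars: "x \<notin> vars M \<Longrightarrow> dup_count M x = 0"
  using dup_count_notin Fv_subset_vars by blast

lemma alpha1_dup_count: "alpha1 M N \<Longrightarrow> M \<in> LamR \<Longrightarrow> dup_count N v = dup_count M v"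
proof (erule alpha1_LamR_cases)
  fix x y M' assume "M = Lam x M'" "y \<notin> vars M'" "N = Lam y (rename (swap x y) M')"
  then show ?thesis
    by (auto simp: dup_count_rename_swap dup_count_notin_vars swap_def)
next
  fix x x1 x2 y M' assume "M = Dup x x1 x2 M'" "y \<notin> vars M'" "y \<noteq> x2" "x1 \<noteq> x2"
    "N = Dup x y x2 (rename (swap x1 y) M')"
  then show ?thesis
    by (auto simp: dup_count_rename_swap dup_count_notin_vars swap_def)
next
  fix x x1 x2 y M' assume "M = Dup x x1 x2 M'" "y \<notin> vars M'" "y \<noteq> x1" "x1 \<noteq> x2"
    "N = Dup x x1 y (rename (swap x2 y) M')"
  then show ?thesis
    by (auto simp: dup_count_rename_swap dup_count_notin_vars swap_def)
qed simp

lemma alpha1_ty: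
  assumes "alpha1 M N" "M \<in> LamR" "ty G N \<sigma>"
  shows "ty G M \<sigma>"
  using assms(1)
proof (cases rule: alpha1_LamR_cases)
  case (Lam x y M')
  with assms obtain G' \<tau> where G': "G = G'(y := {#})" "\<sigma> = Arr (G' y) \<tau>"
    "ty (G' \<circ> swap x y) M' \<tau>" by (auto elim!: ty_LamE simp: ty_rename_iff involution_swap)
  have y: "y \<notin> Fv M'" using Lam Fv_subset_vars by blast
  \<comment> \<open>In terms of \<open>G'\<close> this says \<open>G' x = {#}\<close>: the old name
    has left the body, so emptying \<open>y\<close> in \<open>G'\<close> equals swapping and then
    emptying \<open>x\<close>.\<close>
  have "(G' \<circ> swap x y) y = {#}" using ty_support[OF G'(3) y] .
  then have "G = (G' \<circ> swap x y)(x := {#})" using G'(1) by (auto simp: swap_def fun_eq_iff)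
  moreover have "\<sigma> = Arr ((G' \<circ> swap x y) x) \<tau>" using G'(2) by (simp add: swap_def)
  ultimately show ?thesis using ty.Lam[OF G'(3), of x] Lam(1) by simp
next
  case (Dup1 x x1 x2 y M')
  with assms obtain G' where G': "G = G'(y := {#}, x2 := {#}, x := G' y + G' x2)"
    "ty (G' \<circ> swap x1 y) M' \<sigma>" by (auto elim!: ty_DupE simp: ty_rename_iff involution_swap)
  have y: "y \<notin> Fv M'" using Dup1 Fv_subset_vars by blast
  have "(G' \<circ> swap x1 y) y = {#}" using ty_support[OF G'(2) y] .
  then have "G = (G' \<circ> swap x1 y)(x1 := {#}, x2 := {#}, x := (G' \<circ> swap x1 y) x1 + (G' \<circ> swap x1 y) x2)"
    using G'(1) Dup1 by (auto simp: swap_def fun_eq_iff)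
  then show ?thesis using ty.Dup[OF G'(2), of x1 x2 x] Dup1(1) by simp
next
  case (Dup2 x x1 x2 y M')
  with assms obtain G' where G': "G = G'(x1 := {#}, y := {#}, x := G' x1 + G' y)"
    "ty (G' \<circ> swap x2 y) M' \<sigma>" by (auto elim!: ty_DupE simp: ty_rename_iff involution_swap)
  have y: "y \<notin> Fv M'" using Dup2 Fv_subset_vars by blast
  have "(G' \<circ> swap x2 y) y = {#}" using ty_support[OF G'(2) y] .
  then have "G = (G' \<circ> swap x2 y)(x1 := {#}, x2 := {#}, x := (G' \<circ> swap x2 y) x1 + (G' \<circ> swap x2 y) x2)"
    using G'(1) Dup2 by (auto simp: swap_def fun_eq_iff)
  then show ?thesis using ty.Dup[OF G'(2), of x1 x2 x] Dup2(1) by simp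
qed (use assms in auto)

text \<open>Only binders at the root are renamed, and only forwards. This suffices because freshness
  is always wanted for the outermost binder, and it keeps the term inside
  \<open>LamR\<close>.\<close>

abbreviation alpha1s :: "trm \<Rightarrow> trm \<Rightarrow> bool" where
  "alpha1s \<equiv> alpha1\<^sup>*\<^sup>*"

lemma alpha1s_invariants:
  assumes "alpha1s M N" "M \<in> LamR"
  shows "N \<in> LamR" "Fv N = Fv M" "size N = size M" "dup_count N = dup_count M"
    "ty G N \<sigma> \<Longrightarrow> ty G M \<sigma>"
proof -
  have "N \<in> LamR \<and> Fv N = Fv M \<and> size N = size M \<and> dup_count N = dup_count M \<and>
      (ty G N \<sigma> \<longrightarrow> ty G M \<sigma>)"
    using assms
  proof (induction rule: rtranclp_induct)
    case (step P Q)
    moreover from this have "dup_count Q = dup_count P" by (auto simp: alpha1_dup_count)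
    ultimately show ?case
      using alpha1_LamR alpha1_Fv alpha1_size alpha1_ty by metis
  qed simp
  then show "N \<in> LamR" "Fv N = Fv M" "size N = size M" "dup_count N = dup_count M"
    "ty G N \<sigma> \<Longrightarrow> ty G M \<sigma>" by auto
qed

lemma fresh_Lam:
  assumes "finite A"
  obtains y M' where "y \<notin> A" "alpha1s (Lam x M) (Lam y M')"
proof -
  obtain y where "y \<notin> A \<union> vars M"
    using assms finite_vars by (metis ex_new_if_finite finite_Un infinite_UNIV_nat)
  then show thesis using that[of y] alpha1.intros(1)[of y M x] by blast
qed

lemma fresh_Dup:
  assumes "finite A" "Dup x x1 x2 M \<in> LamR"
  obtains y1 y2 M' where "y1 \<notin> A" "y2 \<notin> A" "alpha1s (Dup x x1 x2 M) (Dup x y1 y2 M')"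
proof -
  have ne: "x1 \<noteq> x2" using assms(2) by (auto simp: LamR_iff)
  obtain y1 where y1: "y1 \<notin> A \<union> vars M \<union> {x2}"
    using assms finite_vars
    by (metis ex_new_if_finite finite_Un infinite_UNIV_nat finite.emptyI finite_insert)
  let ?M = "rename (id(x1 := y1)) M"
  obtain y2 where y2: "y2 \<notin> A \<union> vars ?M \<union> {y1}"
    using assms finite_vars
    by (metis ex_new_if_finite finite_Un infinite_UNIV_nat finite.emptyI finite_insert)
  have "alpha1 (Dup x x1 x2 M) (Dup x y1 x2 ?M)" using y1 ne by (intro alpha1.intros) auto
  moreover have "alpha1 (Dup x y1 x2 ?M) (Dup x y1 y2 (rename (id(x2 := y2)) ?M))"
    using y1 y2 by (intro alpha1.intros) auto
  ultimately show thesis using that[of y1 y2] y1 y2 by (meson UnI1 converse_rtranclp_into_rtranclp r_into_rtranclp)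
qed

section \<open>Substitution\<close>

text \<open>One-hole contexts as functions. Quantifying over \<open>R\<close> lets one notion serve
  alpha-conversion, structural equivalence, reduction and the rewriting of explicit
  substitutions.\<close>

definition ctx_closed :: "(trm \<Rightarrow> trm) \<Rightarrow> bool" where
  "ctx_closed C \<longleftrightarrow> (\<forall>R M N. ctx R M N \<longrightarrow> ctx R (C M) (C N))"

lemma ctx_closed_intros:
  "ctx_closed (Lam x)" "ctx_closed (\<lambda>M. App M N)" "ctx_closed (App N)" "ctx_closed (Era x)"
  "ctx_closed (Dup x x1 x2)" "ctx_closed (\<lambda>M. Sub M x N)"
  by (auto simp: ctx_closed_def intro: ctx.intros)

lemma ctx_closed_dups: "ctx_closed (dups X Y Z)"
proof -
  have "ctx_closed (foldr (\<lambda>(x, y, z). Dup x y z) L)" for L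
    by (induction L) (auto simp: ctx_closed_def intro: ctx.intros)
  moreover have "dups X Y Z = foldr (\<lambda>(x, y, z). Dup x y z) (zip X (zip Y Z))"
    by (auto simp: dups_def)
  ultimately show ?thesis by simp
qed

lemma equivclp_ctx:
  assumes "ctx_closed C"
  shows "equivclp (ctx R) M N \<Longrightarrow> equivclp (ctx R) (C M) (C N)"
proof (induction rule: equivclp_induct)
  case (step P Q)
  then have "ctx R (C P) (C Q) \<or> ctx R (C Q) (C P)"
    using assms by (auto simp: ctx_closed_def)
  with step show ?case by (blast intro: equivclp_into_equivclp)
qed (rule equivclp_refl)

lemma alpha_trans: "alpha M N \<Longrightarrow> alpha N P \<Longrightarrow> alpha M P"
  unfolding alpha_def by (rule equivclp_trans)

lemma alpha_refl: "alpha M M"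
  by (simp add: alpha_def equivclp_refl)

lemma alpha1s_imp_alpha: "alpha1s M N \<Longrightarrow> alpha M N"
proof (induction rule: rtranclp_induct)
  case (step P Q)
  then show ?case unfolding alpha_def by (blast intro: equivclp_into_equivclp ctx.base)
qed (rule alpha_refl)

lemma esub_base: "esub1 M N \<Longrightarrow> esub M N"
  unfolding esub_def using alpha_refl by (blast intro: ctx.base)

lemma alpha_esub: "alpha M N \<Longrightarrow> esub N P \<Longrightarrow> esub M P"
  unfolding esub_def using alpha_trans by blast

lemma esubs_ctx:
  assumes C: "ctx_closed C"
  shows "esub\<^sup>*\<^sup>* M N \<Longrightarrow> esub\<^sup>*\<^sup>* (C M) (C N)"
proof (induction rule: rtranclp_induct)
  case (step P Q)
  have "esub (C P) (C Q)"
    using step(2) C equivclp_ctx[OF C, of alpha1]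
    unfolding esub_def alpha_def ctx_closed_def by blast
  with step show ?case by (meson rtranclp.rtrancl_into_rtrancl)
qed simp

text \<open>The common shape of the rules: one step moves the substitution below \<open>C\<close>,
  and rewriting continues there.\<close>

lemma esub_step_ctx:
  "esub1 M (C N) \<Longrightarrow> ctx_closed C \<Longrightarrow> esub\<^sup>*\<^sup>* N P \<Longrightarrow> esub\<^sup>*\<^sup>* M (C P)"
  by (meson converse_rtranclp_into_rtranclp esub_base esubs_ctx)

text \<open>The argument \<open>T\<close> only fixes the type of type atoms.\<close>

definition is_subst :: "'p itself \<Rightarrow> trm \<Rightarrow> var \<Rightarrow> trm \<Rightarrow> trm \<Rightarrow> bool" where
  "is_subst T M x N P \<longleftrightarrow>
     esub\<^sup>*\<^sup>* (Sub M x N) P \<and> P \<in> LamR \<and> Fv P = (Fv M - {x}) \<union> Fv N \<and>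
     (\<forall>y \<in> Fv M - {x}. dup_count P y = dup_count M y) \<and>
     (\<forall>(G :: 'p env) \<sigma>. ty G P \<sigma> \<longrightarrow>
        (\<exists>G1 H. ty G1 M \<sigma> \<and> msum (\<lambda>H \<tau>. ty H N \<tau>) H (G1 x) \<and> G = G1(x := {#}) + H))"

lemma is_substI:
  fixes T :: "'p itself"
  assumes "esub\<^sup>*\<^sup>* (Sub M x N) P" "P \<in> LamR" "Fv P = (Fv M - {x}) \<union> Fv N"
    "\<And>y. y \<in> Fv M \<Longrightarrow> y \<noteq> x \<Longrightarrow> dup_count P y = dup_count M y"
    "\<And>(G :: 'p env) \<sigma>. ty G P \<sigma> \<Longrightarrow>
      \<exists>G1 H. ty G1 M \<sigma> \<and> msum (\<lambda>H \<tau>. ty H N \<tau>) H (G1 x) \<and> G = G1(x := {#}) + H"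
  shows "is_subst T M x N P"
  using assms unfolding is_subst_def by blast

lemma is_substD:
  fixes T :: "'p itself"
  assumes "is_subst T M x N P"
  shows "esub\<^sup>*\<^sup>* (Sub M x N) P" "P \<in> LamR" "Fv P = (Fv M - {x}) \<union> Fv N"
    "y \<in> Fv M \<Longrightarrow> y \<noteq> x \<Longrightarrow> dup_count P y = dup_count M y"
  using assms unfolding is_subst_def by blast+

lemma is_subst_ty:
  fixes T :: "'p itself" and G :: "'p env"
  assumes "is_subst T M x N P" "ty G P \<sigma>"
  obtains G1 H where "ty G1 M \<sigma>" "msum (\<lambda>H \<tau>. ty H N \<tau>) H (G1 x)" "G = G1(x := {#}) + H"
  using assms unfolding is_subst_def by blast

section \<open>Substitution, one rewriting rule at a time\<close>

lemma is_subst_Var: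
  fixes T :: "'p itself"
  assumes "N \<in> LamR"
  shows "is_subst T (Var x) x N N"
proof (rule is_substI)
  show "esub\<^sup>*\<^sup>* (Sub (Var x) x N) N"
    by (blast intro: esub1.intros esub_base)
  fix G :: "'p env" and \<sigma> assume "ty G N \<sigma>"
  then have "msum (\<lambda>H \<tau>. ty H N \<tau>) (G + 0) {#\<sigma>#}"
    by (intro msum.intros)
  then have "msum (\<lambda>H \<tau>. ty H N \<tau>) G ((0(x := {#\<sigma>#})) x)"
    by simp
  moreover have "G = (0(x := {#\<sigma>#}))(x := {#}) + G"
    by (auto simp: fun_eq_iff)
  ultimately show "\<exists>G1 H. ty G1 (Var x) \<sigma> \<and> msum (\<lambda>H \<tau>. ty H N \<tau>) H (G1 x) \<and> G = G1(x := {#}) + H"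
    using ty.Var by blast
qed (use assms in auto)

lemma is_subst_Lam:
  fixes T :: "'p itself"
  assumes P: "is_subst T M x N P" and M: "Lam y M \<in> LamR" and y: "y \<noteq> x" "y \<notin> Fv N"
  shows "is_subst T (Lam y M) x N (Lam y P)"
proof (rule is_substI)
  have M': "y \<in> Fv M" using M by (auto simp: LamR_iff)
  show "esub\<^sup>*\<^sup>* (Sub (Lam y M) x N) (Lam y P)"
    using y is_substD(1)[OF P] by (blast intro: esub_step_ctx esub1.intros ctx_closed_intros)
  show "Lam y P \<in> LamR" using is_substD[OF P] y M' by (auto simp: LamR_iff LamR.Var)
  show "Fv (Lam y P) = Fv (Lam y M) - {x} \<union> Fv N" using is_substD(3)[OF P] y by auto
  show "dup_count (Lam y P) v = dup_count (Lam y M) v" if "v \<in> Fv (Lam y M)" "v \<noteq> x" for v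
    using that is_substD(4)[OF P] by auto
  fix G :: "'p env" and \<sigma> assume "ty G (Lam y P) \<sigma>"
  then obtain G' \<tau> where G': "G = G'(y := {#})" "\<sigma> = Arr (G' y) \<tau>" "ty G' P \<tau>"
    by (auto elim: ty_LamE)
  obtain G1 H where *: "ty G1 M \<tau>" "msum (\<lambda>H \<tau>. ty H N \<tau>) H (G1 x)" "G' = G1(x := {#}) + H"
    using is_subst_ty[OF P G'(3)] .
  \<comment> \<open>The argument does not mention \<open>y\<close>, so the abstracted type is the
    one that the body gives to \<open>y\<close>.\<close>
  have H: "H y = {#}" using msum_ty_support[OF *(2) y(2)] .
  have "ty (G1(y := {#})) (Lam y M) \<sigma>"
    using ty.Lam[OF *(1), of y] y G'(2) H *(3) by simp
  moreover have "G = (G1(y := {#}))(x := {#}) + H"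
    using H G'(1) *(3) y by (auto simp: fun_eq_iff)
  ultimately show "\<exists>G1 H. ty G1 (Lam y M) \<sigma> \<and> msum (\<lambda>H \<tau>. ty H N \<tau>) H (G1 x) \<and> G = G1(x := {#}) + H"
    using *(2) y by (metis fun_upd_other)
qed

lemma is_subst_AppL:
  fixes T :: "'p itself"
  assumes P: "is_subst T M x N P" and M: "App M Q \<in> LamR" and x: "x \<in> Fv M"
    and dis: "Fv Q \<inter> Fv N = {}"
  shows "is_subst T (App M Q) x N (App P Q)"
proof (rule is_substI)
  have M': "Q \<in> LamR" "Fv M \<inter> Fv Q = {}" using M by (auto simp: LamR_iff)
  show "esub\<^sup>*\<^sup>* (Sub (App M Q) x N) (App P Q)"
    using esub_step_ctx[OF esub1.intros(3)[OF x] ctx_closed_intros(2) is_substD(1)[OF P]] .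
  show "App P Q \<in> LamR" using is_substD[OF P] dis M' by (auto simp: LamR_iff)
  show "Fv (App P Q) = Fv (App M Q) - {x} \<union> Fv N" using is_substD(3)[OF P] x M' by auto
  show "dup_count (App P Q) v = dup_count (App M Q) v" if v: "v \<in> Fv (App M Q)" "v \<noteq> x" for v
  proof (cases "v \<in> Fv M")
    case False
    then have "v \<notin> Fv P" using is_substD(3)[OF P] v dis by auto
    then show ?thesis using False by (simp add: dup_count_notin)
  qed (use v is_substD(4)[OF P] in auto)
  fix G :: "'p env" and \<sigma> assume "ty G (App P Q) \<sigma>"
  then obtain G' \<alpha> K \<tau>0 and K0 :: "'p env" where G': "G = G' + K" "ty G' P (Arr \<alpha> \<sigma>)"
    "msum (\<lambda>H \<tau>. ty H Q \<tau>) K \<alpha>" "ty K0 Q \<tau>0" by (auto elim: ty_AppE)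
  obtain G1 H where *: "ty G1 M (Arr \<alpha> \<sigma>)" "msum (\<lambda>H \<tau>. ty H N \<tau>) H (G1 x)" "G' = G1(x := {#}) + H"
    using is_subst_ty[OF P G'(2)] .
  have K: "K x = {#}" using msum_ty_support[OF G'(3)] x M' by blast
  have "ty (G1 + K) (App M Q) \<sigma>" using *(1) G'(3,4) by (rule ty.App)
  moreover have "(G1 + K) x = G1 x" using K by simp
  moreover have "G = (G1 + K)(x := {#}) + H"
    using K G'(1) *(3) by (auto simp: fun_eq_iff ac_simps)
  ultimately show "\<exists>G1 H. ty G1 (App M Q) \<sigma> \<and> msum (\<lambda>H \<tau>. ty H N \<tau>) H (G1 x) \<and> G = G1(x := {#}) + H"
    using *(2) by metis
qed

text \<open>The argument of an application is typed once per element of an intersection, and each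
  typing splits in its own way. The splittings add up because the types of \<open>x\<close>
  do.\<close>

lemma msum_split:
  assumes "\<And>G \<sigma>. R G \<sigma> \<Longrightarrow> \<exists>G1 H. S G1 \<sigma> \<and> msum Q H (G1 x) \<and> G = G1(x := {#}) + H"
  shows "msum R G \<alpha> \<Longrightarrow> \<exists>G1 H. msum S G1 \<alpha> \<and> msum Q H (G1 x) \<and> G = G1(x := {#}) + H"
proof (induction rule: msum.induct)
  case empty
  have "(0 :: 'a env) = 0(x := {#}) + 0" by (auto simp: fun_eq_iff)
  moreover have "msum Q 0 ((0 :: 'a env) x)" by (simp add: msum.empty)
  ultimately show ?case using msum.empty by blast
next
  case (add G \<tau> H \<alpha>)
  obtain G1 K where 1: "S G1 \<tau>" "msum Q K (G1 x)" "G = G1(x := {#}) + K"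
    using assms[OF add(1)] by blast
  obtain G2 L where 2: "msum S G2 \<alpha>" "msum Q L (G2 x)" "H = G2(x := {#}) + L"
    using add.IH by blast
  have "msum S (G1 + G2) (add_mset \<tau> \<alpha>)" using 1 2 by (intro msum.add)
  moreover have "msum Q (K + L) ((G1 + G2) x)" using msum_plus[OF 1(2) 2(2)] by simp
  moreover have "G + H = (G1 + G2)(x := {#}) + (K + L)"
    using 1 2 by (auto simp: fun_eq_iff ac_simps)
  ultimately show ?case by blast
qed

lemma is_subst_AppR:
  fixes T :: "'p itself"
  assumes P: "is_subst T M x N P" and M: "App Q M \<in> LamR" and x: "x \<in> Fv M"
    and dis: "Fv Q \<inter> Fv N = {}"
  shows "is_subst T (App Q M) x N (App Q P)"
proof (rule is_substI)
  have M': "Q \<in> LamR" "Fv Q \<inter> Fv M = {}" using M by (auto simp: LamR_iff)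
  show "esub\<^sup>*\<^sup>* (Sub (App Q M) x N) (App Q P)"
    using esub_step_ctx[OF esub1.intros(4)[OF x] ctx_closed_intros(3) is_substD(1)[OF P]] .
  show "App Q P \<in> LamR" using is_substD[OF P] dis M' by (auto simp: LamR_iff)
  show "Fv (App Q P) = Fv (App Q M) - {x} \<union> Fv N" using is_substD(3)[OF P] x M' by auto
  show "dup_count (App Q P) v = dup_count (App Q M) v" if v: "v \<in> Fv (App Q M)" "v \<noteq> x" for v
  proof (cases "v \<in> Fv M")
    case False
    then have "v \<notin> Fv P" using is_substD(3)[OF P] v dis by auto
    then show ?thesis using False by (simp add: dup_count_notin)
  qed (use v is_substD(4)[OF P] in auto)
  fix G :: "'p env" and \<sigma> assume "ty G (App Q P) \<sigma>"
  then obtain G' \<alpha> K \<tau>0 and K0 :: "'p env" where G': "G = G' + K" "ty G' Q (Arr \<alpha> \<sigma>)"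
    "msum (\<lambda>H \<tau>. ty H P \<tau>) K \<alpha>" "ty K0 P \<tau>0" by (auto elim: ty_AppE)
  have "\<exists>G1 H. ty G1 M \<sigma> \<and> msum (\<lambda>H \<tau>. ty H N \<tau>) H (G1 x) \<and> G = G1(x := {#}) + H"
    if "ty G P \<sigma>" for G :: "'p env" and \<sigma>
    using is_subst_ty[OF P that] by metis
  from msum_split[where R = "\<lambda>H \<tau>. ty H P \<tau>" and S = "\<lambda>H \<tau>. ty H M \<tau>"
      and Q = "\<lambda>H \<tau>. ty H N \<tau>", OF this G'(3)]
  obtain G1 H where *: "msum (\<lambda>H \<tau>. ty H M \<tau>) G1 \<alpha>" "msum (\<lambda>H \<tau>. ty H N \<tau>) H (G1 x)"
    "K = G1(x := {#}) + H" by blast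
  \<comment> \<open>\<open>ty.App\<close> wants some typing of \<open>M\<close> even if
    \<open>\<alpha>\<close> is empty; it comes from splitting the corresponding typing of
    \<open>P\<close>.\<close>
  obtain K1 where "ty (K1 :: 'p env) M \<tau>0" using is_subst_ty[OF P G'(4)] by metis
  with G'(2) *(1) have "ty (G' + G1) (App Q M) \<sigma>" by (rule ty.App)
  moreover have G'x: "G' x = {#}" using ty_support[OF G'(2)] x M' by blast
  moreover from this have "(G' + G1) x = G1 x" by simp
  moreover have "G = (G' + G1)(x := {#}) + H"
    using G'x G'(1) *(3) by (auto simp: fun_eq_iff ac_simps)
  ultimately show "\<exists>G1 H. ty G1 (App Q M) \<sigma> \<and> msum (\<lambda>H \<tau>. ty H N \<tau>) H (G1 x) \<and> G = G1(x := {#}) + H"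
    using *(2) by metis
qed

lemma is_subst_Era:
  fixes T :: "'p itself"
  assumes P: "is_subst T M x N P" and M: "Era y M \<in> LamR" and y: "y \<noteq> x" "y \<notin> Fv N"
  shows "is_subst T (Era y M) x N (Era y P)"
proof (rule is_substI)
  have M': "y \<notin> Fv M" using M by (auto simp: LamR_iff)
  show "esub\<^sup>*\<^sup>* (Sub (Era y M) x N) (Era y P)"
    using y is_substD(1)[OF P] by (blast intro: esub_step_ctx esub1.intros ctx_closed_intros)
  show "Era y P \<in> LamR" using is_substD[OF P] y M' by (auto simp: LamR_iff LamR.Var)
  show "Fv (Era y P) = Fv (Era y M) - {x} \<union> Fv N" using is_substD(3)[OF P] y by auto
  show "dup_count (Era y P) v = dup_count (Era y M) v" if "v \<in> Fv (Era y M)" "v \<noteq> x" for v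
    using that is_substD[OF P] M' y by (cases "v = y") (auto simp: dup_count_notin)
  fix G :: "'p env" and \<sigma> assume "ty G (Era y P) \<sigma>"
  then have "ty G P \<sigma>" by (auto elim: ty_EraE)
  then show "\<exists>G1 H. ty G1 (Era y M) \<sigma> \<and> msum (\<lambda>H \<tau>. ty H N \<tau>) H (G1 x) \<and> G = G1(x := {#}) + H"
    using is_subst_ty[OF P] ty.Era by metis
qed

lemma eras_simps: "eras [] M = M" "eras (x # X) M = Era x (eras X M)"
  by (simp_all add: eras_def)

lemma Fv_eras: "Fv (eras X M) = set X \<union> Fv M"
  by (induction X) (auto simp: eras_simps)

lemma eras_LamR: "M \<in> LamR \<Longrightarrow> distinct X \<Longrightarrow> set X \<inter> Fv M = {} \<Longrightarrow> eras X M \<in> LamR"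
  by (induction X) (auto simp: eras_simps Fv_eras intro!: LamR.intros)

lemma dup_count_eras: "dup_count (eras X M) = dup_count M"
  by (induction X) (auto simp: eras_simps)

lemma ty_eras: "ty G (eras X M) \<sigma> \<Longrightarrow> ty G M \<sigma>"
  by (induction X) (auto simp: eras_simps elim: ty_EraE)

text \<open>Here \<open>N\<close> disappears and only its free variables survive, as erasures. The
  type of \<open>x\<close> is \<open>{#}\<close>, so the empty family of typings of \<open>N\<close>
  is the right one.\<close>

lemma is_subst_Era_same:
  fixes T :: "'p itself"
  assumes N: "N \<in> LamR" and M: "Era x M \<in> LamR" and dis: "Fv M \<inter> Fv N = {}"
  shows "is_subst T (Era x M) x N (eras (fv_list N) M)"
proof (rule is_substI)
  have M': "M \<in> LamR" "x \<notin> Fv M" using M by (auto simp: LamR_iff)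
  show "esub\<^sup>*\<^sup>* (Sub (Era x M) x N) (eras (fv_list N) M)"
    by (blast intro: esub1.intros esub_base)
  show "eras (fv_list N) M \<in> LamR"
    by (rule eras_LamR) (use N M' dis in \<open>auto simp: distinct_fv_list set_fv_list\<close>)
  show "Fv (eras (fv_list N) M) = Fv (Era x M) - {x} \<union> Fv N"
    using M' by (auto simp: Fv_eras set_fv_list)
  show "dup_count (eras (fv_list N) M) v = dup_count (Era x M) v" for v
    by (simp add: dup_count_eras)
  fix G :: "'p env" and \<sigma> assume "ty G (eras (fv_list N) M) \<sigma>"
  then have G: "ty G M \<sigma>" by (rule ty_eras)
  have x: "G x = {#}" using ty_support[OF G] M' by blast
  have "G = G(x := {#}) + 0" using x by (auto simp: fun_eq_iff)
  moreover have "msum (\<lambda>H \<tau>. ty H N \<tau>) 0 (G x)" unfolding x by (rule msum.empty)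
  ultimately show "\<exists>G1 H. ty G1 (Era x M) \<sigma> \<and> msum (\<lambda>H \<tau>. ty H N \<tau>) H (G1 x) \<and> G = G1(x := {#}) + H"
    using ty.Era[OF G] by blast
qed

lemma is_subst_Dup:
  fixes T :: "'p itself"
  assumes P: "is_subst T M x N P" and M: "Dup y y1 y2 M \<in> LamR"
    and y: "y \<noteq> x" "x \<noteq> y1" "x \<noteq> y2" "y \<notin> Fv N" "y1 \<notin> Fv N" "y2 \<notin> Fv N"
  shows "is_subst T (Dup y y1 y2 M) x N (Dup y y1 y2 P)"
proof (rule is_substI)
  have M': "y1 \<noteq> y2" "y1 \<in> Fv M" "y2 \<in> Fv M" "y \<notin> Fv M - {y1, y2}" using M by (auto simp: LamR_iff)
  show "esub\<^sup>*\<^sup>* (Sub (Dup y y1 y2 M) x N) (Dup y y1 y2 P)"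
    by (rule esub_step_ctx[OF esub1.intros(7) ctx_closed_intros(5) is_substD(1)[OF P]]) (use y in auto)
  show "Dup y y1 y2 P \<in> LamR" using is_substD[OF P] y M' by (auto simp: LamR_iff)
  show "Fv (Dup y y1 y2 P) = Fv (Dup y y1 y2 M) - {x} \<union> Fv N" using is_substD(3)[OF P] y by auto
  show "dup_count (Dup y y1 y2 P) v = dup_count (Dup y y1 y2 M) v"
    if "v \<in> Fv (Dup y y1 y2 M)" "v \<noteq> x" for v
    using that is_substD(4)[OF P] M' y by auto
  fix G :: "'p env" and \<sigma> assume "ty G (Dup y y1 y2 P) \<sigma>"
  then obtain G' where G': "G = G'(y1 := {#}, y2 := {#}, y := G' y1 + G' y2)" "ty G' P \<sigma>"
    by (auto elim: ty_DupE)
  obtain G1 H where *: "ty G1 M \<sigma>" "msum (\<lambda>H \<tau>. ty H N \<tau>) H (G1 x)" "G' = G1(x := {#}) + H"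
    using is_subst_ty[OF P G'(2)] .
  have H: "H y = {#}" "H y1 = {#}" "H y2 = {#}" using msum_ty_support[OF *(2)] y by blast+
  let ?G = "G1(y1 := {#}, y2 := {#}, y := G1 y1 + G1 y2)"
  have "ty ?G (Dup y y1 y2 M) \<sigma>" using *(1) by (rule ty.Dup)
  moreover have "G = ?G(x := {#}) + H"
    using H G'(1) *(3) y by (auto simp: fun_eq_iff)
  moreover have "?G x = G1 x" using y by auto
  ultimately show "\<exists>G1 H. ty G1 (Dup y y1 y2 M) \<sigma> \<and> msum (\<lambda>H \<tau>. ty H N \<tau>) H (G1 x) \<and> G = G1(x := {#}) + H"
    using *(2) by metis
qed

section \<open>Blocks of duplications and substitution for a duplicated variable\<close>

lemma dups_simps:
  "dups [] [] [] M = M" "dups (x # X) (y # Y) (z # Z) M = Dup x y z (dups X Y Z M)"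
  by (simp_all add: dups_def)

text \<open>Writing both lists of copies as images of \<open>L\<close> keeps the three lists equally
  long. Distinctness prevents one duplication from binding a name that another one
  introduces.\<close>

lemma Fv_dups:
  "distinct (L @ map f L @ map g L) \<Longrightarrow>
   Fv (dups L (map f L) (map g L) P) = set L \<union> (Fv P - f ` set L - g ` set L)"
  by (induction L) (auto simp: dups_simps)

lemma dups_LamR:
  "P \<in> LamR \<Longrightarrow> distinct (L @ map f L @ map g L) \<Longrightarrow> set L \<inter> Fv P = {} \<Longrightarrow>
   f ` set L \<subseteq> Fv P \<Longrightarrow> g ` set L \<subseteq> Fv P \<Longrightarrow> dups L (map f L) (map g L) P \<in> LamR"
proof (induction L)
  case (Cons v L)
  have d: "distinct (L @ map f L @ map g L)" using Cons.prems by auto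
  have "dups L (map f L) (map g L) P \<in> LamR" using Cons by auto
  moreover have "f v \<in> Fv (dups L (map f L) (map g L) P)" "g v \<in> Fv (dups L (map f L) (map g L) P)"
    "v \<notin> Fv (dups L (map f L) (map g L) P)" "f v \<noteq> g v"
    using Cons.prems by (auto simp: Fv_dups[OF d])
  ultimately show ?case by (auto simp: dups_simps intro: LamR.intros)
qed (simp add: dups_simps)

lemma dup_count_dups:
  "v \<notin> set L \<Longrightarrow> v \<notin> f ` set L \<Longrightarrow> v \<notin> g ` set L \<Longrightarrow>
   dup_count (dups L (map f L) (map g L) P) v = dup_count P v"
  by (induction L) (auto simp: dups_simps)

lemma ty_dups:
  "ty G (dups L (map f L) (map g L) P) \<sigma> \<Longrightarrow> distinct (L @ map f L @ map g L) \<Longrightarrow>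
   \<exists>G'. ty G' P \<sigma> \<and> (\<forall>v \<in> set L. G v = G' (f v) + G' (g v)) \<and>
     (\<forall>v. v \<notin> set L \<longrightarrow> v \<notin> f ` set L \<longrightarrow> v \<notin> g ` set L \<longrightarrow> G v = G' v)"
proof (induction L arbitrary: G)
  case (Cons v L)
  from Cons.prems(1) obtain K where K: "G = K(f v := {#}, g v := {#}, v := K (f v) + K (g v))"
    "ty K (dups L (map f L) (map g L) P) \<sigma>"
    by (auto simp: dups_simps elim: ty_DupE)
  have d: "distinct (L @ map f L @ map g L)" using Cons.prems(2) by auto
  from Cons.IH[OF K(2) d] obtain G' where G': "ty G' P \<sigma>"
    "\<forall>v \<in> set L. K v = G' (f v) + G' (g v)"
    "\<forall>v. v \<notin> set L \<longrightarrow> v \<notin> f ` set L \<longrightarrow> v \<notin> g ` set L \<longrightarrow> K v = G' v" by blast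
  have "G u = G' (f u) + G' (g u)" if "u \<in> set (v # L)" for u
  proof (cases "u = v")
    case True
    \<comment> \<open>The copies of \<open>v\<close> lie outside the inner block, which therefore
      leaves their types unchanged.\<close>
    have "f v \<notin> set L \<union> f ` set L \<union> g ` set L" "g v \<notin> set L \<union> f ` set L \<union> g ` set L"
      using Cons.prems(2) by auto
    then have "K (f v) = G' (f v)" "K (g v) = G' (g v)" using G'(3) by auto
    then show ?thesis using True K(1) by simp
  next
    case False
    then have "u \<in> set L" "u \<noteq> f v" "u \<noteq> g v" using that Cons.prems(2) by auto
    then show ?thesis using False G'(2) K(1) by simp
  qed
  moreover have "G u = G' u"
    if "u \<notin> set (v # L)" "u \<notin> f ` set (v # L)" "u \<notin> g ` set (v # L)" for u
    using that G'(3) K(1) by simp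
  ultimately show ?case using G'(1) by blast
qed (auto simp: dups_simps)

lemma msum_rename_ty:
  assumes "involution \<pi>" "msum (\<lambda>H \<tau>. ty H (rename \<pi> N) \<tau>) H \<alpha>"
  shows "msum (\<lambda>H \<tau>. ty H N \<tau>) (H \<circ> \<pi>) \<alpha>"
  using assms(2) by (rule msum_map) (use assms(1) ty_rename_iff in blast)

lemma ex_fresh_involution:
  assumes "finite A" "Fv N \<subseteq> A"
  obtains \<pi> where "involution \<pi>" "\<pi> ` Fv N \<inter> A = {}" "\<And>v. v \<in> A \<Longrightarrow> v \<notin> Fv N \<Longrightarrow> \<pi> v = v"
proof -
  obtain K where K: "\<And>v. v \<in> A \<Longrightarrow> v < K"
    using assms(1) by (auto simp: finite_nat_set_iff_bounded)
  \<comment> \<open>\<open>K\<close> exceeds every member of \<open>A\<close>. Exchanging each free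
    variable \<open>v\<close> with \<open>v + K\<close> thus sends it outside \<open>A\<close> and
    fixes all other members of \<open>A\<close>.\<close>
  define \<pi> where "\<pi> v = (if v \<in> Fv N then v + K else if K \<le> v \<and> v - K \<in> Fv N then v - K else v)" for v
  have K': "v < K" if "v \<in> Fv N" for v using that K assms(2) by blast
  show thesis
  proof (rule that[of \<pi>])
    show "involution \<pi>"
      unfolding involution_def \<pi>_def using K' by (auto dest: K')
    show "\<pi> ` Fv N \<inter> A = {}" unfolding \<pi>_def using K by fastforce
    show "\<pi> v = v" if "v \<in> A" "v \<notin> Fv N" for v
      using that K[of v] by (auto simp: \<pi>_def)
  qed
qed

text \<open>\<open>fresh_renaming\<close> demands the identity outside \<open>Fv N\<close>, whereas
  an involution also moves the fresh names back; hence the restriction to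
  \<open>Fv N\<close>.\<close>

lemma fresh_renaming_involution:
  assumes "involution \<pi>" "\<pi> ` Fv N \<inter> A = {}"
  shows "fresh_renaming (\<lambda>v. if v \<in> Fv N then \<pi> v else v) N A"
  using assms by (auto simp: fresh_renaming_def inj_on_def involution_eq_iff)

text \<open>The two copies are substituted one after the other. The typings of the copies, renamed
  back to typings of \<open>N\<close>, are joined into one family for the intersection of the types
  of \<open>x1\<close> and \<open>x2\<close>.\<close>

lemma is_subst_Dup_same:
  fixes T :: "'p itself"
  assumes N: "N \<in> LamR" and M: "Dup x x1 x2 M \<in> LamR" and dis: "(Fv M - {x1, x2}) \<inter> Fv N = {}"
    and \<pi>1: "involution \<pi>1" "\<pi>1 ` Fv N \<inter> (vars M \<union> vars N \<union> {x, x1, x2}) = {}"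
      "\<And>v. v \<in> vars N \<Longrightarrow> v \<notin> Fv N \<Longrightarrow> \<pi>1 v = v"
    and \<pi>2: "involution \<pi>2" "\<pi>2 ` Fv N \<inter> (vars M \<union> vars N \<union> {x, x1, x2} \<union> \<pi>1 ` Fv N) = {}"
      "\<And>v. v \<in> vars N \<Longrightarrow> v \<notin> Fv N \<Longrightarrow> \<pi>2 v = v"
    and P1: "is_subst T M x1 (rename \<pi>1 N) P1"
    and P2: "is_subst T P1 x2 (rename \<pi>2 N) P2"
  shows "is_subst T (Dup x x1 x2 M) x N (dups (fv_list N) (map \<pi>1 (fv_list N)) (map \<pi>2 (fv_list N)) P2)"
proof (rule is_substI)
  let ?L = "fv_list N" and ?f1 = "\<lambda>v. if v \<in> Fv N then \<pi>1 v else v"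
    and ?f2 = "\<lambda>v. if v \<in> Fv N then \<pi>2 v else v"
  let ?P = "dups ?L (map \<pi>1 ?L) (map \<pi>2 ?L) P2"
  let ?N1 = "rename \<pi>1 N" and ?N2 = "rename \<pi>2 N"
  have M': "x1 \<noteq> x2" "x1 \<in> Fv M" "x2 \<in> Fv M" "x \<notin> Fv M - {x1, x2}" "M \<in> LamR"
    using M by (auto simp: LamR_iff)
  have FN: "Fv ?N1 = \<pi>1 ` Fv N" "Fv ?N2 = \<pi>2 ` Fv N" using \<pi>1 \<pi>2 by (simp_all add: Fv_rename)
  have V: "Fv M \<subseteq> vars M" "Fv N \<subseteq> vars N" by (rule Fv_subset_vars)+
  have FP1: "Fv P1 = (Fv M - {x1}) \<union> \<pi>1 ` Fv N" using is_substD(3)[OF P1] FN by simp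
  have x2: "x2 \<notin> \<pi>1 ` Fv N" using \<pi>1(2) by auto
  have x1: "x1 \<notin> \<pi>1 ` Fv N" using \<pi>1(2) by auto
  have x12: "x1 \<notin> \<pi>2 ` Fv N" using \<pi>2(2) by auto
  have FP2: "Fv P2 = (Fv M - {x1, x2}) \<union> \<pi>1 ` Fv N \<union> \<pi>2 ` Fv N"
    using is_substD(3)[OF P2] FN FP1 x2 by auto
  have f1_vars: "\<pi>1 ` Fv N \<inter> Fv M = {}" "\<pi>1 ` Fv N \<inter> Fv N = {}" using \<pi>1(2) V by blast+
  have f2_vars: "\<pi>2 ` Fv N \<inter> Fv M = {}" "\<pi>2 ` Fv N \<inter> Fv N = {}" "\<pi>2 ` Fv N \<inter> \<pi>1 ` Fv N = {}"
    using \<pi>2(2) V by blast+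
  have inj: "inj_on \<pi>1 A" "inj_on \<pi>2 A" for A
    using \<pi>1(1) \<pi>2(1) by (auto simp: inj_on_def involution_eq_iff)
  have d: "distinct (?L @ map \<pi>1 ?L @ map \<pi>2 ?L)"
    using f1_vars f2_vars inj by (auto simp: distinct_fv_list[OF N] distinct_map set_fv_list)
  note Fd = Fv_dups[where L = ?L and f = \<pi>1 and g = \<pi>2, OF d]
  \<comment> \<open>The two maps agree on all names of \<open>N\<close>, since \<open>\<pi>1\<close>
    fixes those that are not free.\<close>
  have N1: "rename ?f1 N = ?N1" by (rule tm.map_cong0) (use \<pi>1(3) in auto)
  have N2: "rename ?f2 N = ?N2" by (rule tm.map_cong0) (use \<pi>2(3) in auto)
  have im: "?f1 ` Fv N = \<pi>1 ` Fv N" by auto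
  have "esub1 (Sub (Dup x x1 x2 M) x N)
         (dups ?L (fv_list ?N1) (fv_list ?N2) (Sub (Sub M x1 ?N1) x2 ?N2))"
    by (rule esub1.intros(8)[of ?f1 N M x x1 x2 ?f2 ?N1 ?N2])
      (unfold im, use \<pi>1 \<pi>2 fresh_renaming_involution N1 N2 in auto)
  then have e1: "esub1 (Sub (Dup x x1 x2 M) x N)
         (dups ?L (map \<pi>1 ?L) (map \<pi>2 ?L) (Sub (Sub M x1 ?N1) x2 ?N2))"
    using \<pi>1(1) \<pi>2(1) by (simp add: fv_list_rename)
  have "esub\<^sup>*\<^sup>* (Sub (Sub M x1 ?N1) x2 ?N2) (Sub P1 x2 ?N2)"
    by (rule esubs_ctx[OF ctx_closed_intros(6) is_substD(1)[OF P1]])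
  also have "esub\<^sup>*\<^sup>* (Sub P1 x2 ?N2) P2" by (rule is_substD(1)[OF P2])
  finally show "esub\<^sup>*\<^sup>* (Sub (Dup x x1 x2 M) x N) ?P"
    by (rule esub_step_ctx[OF e1 ctx_closed_dups])
  have "Fv N \<inter> Fv P2 = {}" "\<pi>1 ` Fv N \<subseteq> Fv P2" "\<pi>2 ` Fv N \<subseteq> Fv P2"
    unfolding FP2 using f1_vars f2_vars dis by blast+
  then show "?P \<in> LamR"
    by (intro dups_LamR[where L = ?L and f = \<pi>1 and g = \<pi>2] is_substD(2)[OF P2] d)
      (simp_all only: set_fv_list)
  show "Fv ?P = Fv (Dup x x1 x2 M) - {x} \<union> Fv N"
    unfolding Fd FP2 set_fv_list using M' f1_vars f2_vars by auto
  show "dup_count ?P v = dup_count (Dup x x1 x2 M) v" if v: "v \<in> Fv (Dup x x1 x2 M)" "v \<noteq> x" for v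
  proof -
    have v': "v \<in> Fv M" "v \<noteq> x1" "v \<noteq> x2" using v by auto
    then have "v \<notin> Fv N" "v \<notin> \<pi>1 ` Fv N" "v \<notin> \<pi>2 ` Fv N" using f1_vars f2_vars dis by auto
    then have "dup_count ?P v = dup_count P2 v" by (simp add: dup_count_dups set_fv_list)
    also have "\<dots> = dup_count P1 v" using is_substD(4)[OF P2] v' FP1 by blast
    also have "\<dots> = dup_count M v" using is_substD(4)[OF P1] v' by blast
    finally show ?thesis using v v' by simp
  qed
  fix G :: "'p env" and \<sigma> assume "ty G ?P \<sigma>"
  then obtain G' where G': "ty G' P2 \<sigma>" "\<forall>v \<in> Fv N. G v = G' (\<pi>1 v) + G' (\<pi>2 v)"
    "\<forall>v. v \<notin> Fv N \<longrightarrow> v \<notin> \<pi>1 ` Fv N \<longrightarrow> v \<notin> \<pi>2 ` Fv N \<longrightarrow> G v = G' v"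
    and GP: "ty G ?P \<sigma>"
    using ty_dups[where L = ?L and f = \<pi>1 and g = \<pi>2, OF _ d] unfolding set_fv_list by blast
  obtain G1 H2 where G1: "ty G1 P1 \<sigma>" "msum (\<lambda>H \<tau>. ty H ?N2 \<tau>) H2 (G1 x2)" "G' = G1(x2 := {#}) + H2"
    using is_subst_ty[OF P2 G'(1)] .
  obtain G0 H1 where G0: "ty G0 M \<sigma>" "msum (\<lambda>H \<tau>. ty H ?N1 \<tau>) H1 (G0 x1)" "G1 = G0(x1 := {#}) + H1"
    using is_subst_ty[OF P1 G1(1)] .
  have H1: "H1 v = {#}" if "v \<notin> \<pi>1 ` Fv N" for v
    using msum_ty_support[OF G0(2)] that FN by simp
  have H2: "H2 v = {#}" if "v \<notin> \<pi>2 ` Fv N" for v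
    using msum_ty_support[OF G1(2)] that FN by simp
  have G0s: "G0 v = {#}" if "v \<notin> Fv M" for v using ty_support[OF G0(1) that] .
  \<comment> \<open>The first copy does not contain \<open>x2\<close>, so substituting it leaves the
    type of \<open>x2\<close> as it was in \<open>M\<close>.\<close>
  have "G1 x2 = G0 x2" using G0(3) M' H1[OF x2] by simp
  then have m: "msum (\<lambda>H \<tau>. ty H N \<tau>) ((H1 \<circ> \<pi>1) + (H2 \<circ> \<pi>2)) (G0 x1 + G0 x2)"
    using msum_plus[OF msum_rename_ty[OF \<pi>1(1) G0(2)] msum_rename_ty[OF \<pi>2(1) G1(2)]] by simp
  let ?G = "G0(x1 := {#}, x2 := {#}, x := G0 x1 + G0 x2)"
  have "ty ?G (Dup x x1 x2 M) \<sigma>" using G0(1) by (rule ty.Dup)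
  moreover have "?G x = G0 x1 + G0 x2" by simp
  moreover have "G = ?G(x := {#}) + ((H1 \<circ> \<pi>1) + (H2 \<circ> \<pi>2))"
  proof
    fix v
    have G'v: "G' u = (if u = x2 then {#} else if u = x1 then H1 u else G0 u + H1 u) + H2 u" for u
      using G1(3) G0(3) by auto
    have HN1: "H1 (\<pi>1 v) = {#}" if "v \<notin> Fv N" using that H1 mem_image_involution[OF \<pi>1(1)]
      by (metis involution_apply[OF \<pi>1(1)])
    have HN2: "H2 (\<pi>2 v) = {#}" if "v \<notin> Fv N" using that H2 mem_image_involution[OF \<pi>2(1)]
      by (metis involution_apply[OF \<pi>2(1)])
    \<comment> \<open>The bases are compared at the variables of \<open>N\<close>, whose types come
      from the two copies, at the names of the copies, which are bound in the result, and
      elsewhere.\<close>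
    consider "v \<in> Fv N" | "v \<notin> Fv N" "v \<in> \<pi>1 ` Fv N \<union> \<pi>2 ` Fv N"
      | "v \<notin> Fv N" "v \<notin> \<pi>1 ` Fv N" "v \<notin> \<pi>2 ` Fv N" by blast
    then show "G v = (?G(x := {#}) + ((H1 \<circ> \<pi>1) + (H2 \<circ> \<pi>2))) v"
    proof cases
      case 1
      have a: "\<pi>1 v \<in> \<pi>1 ` Fv N" "\<pi>2 v \<in> \<pi>2 ` Fv N" using 1 by auto
      have "\<pi>1 v \<noteq> x1" "\<pi>1 v \<noteq> x2" "\<pi>2 v \<noteq> x1" "\<pi>2 v \<noteq> x2" using \<pi>1(2) \<pi>2(2) 1 by auto
      moreover have "\<pi>1 v \<notin> Fv M" "\<pi>2 v \<notin> Fv M" "\<pi>1 v \<notin> \<pi>2 ` Fv N" "\<pi>2 v \<notin> \<pi>1 ` Fv N"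
        using a f1_vars f2_vars by blast+
      ultimately have "G v = H1 (\<pi>1 v) + H2 (\<pi>2 v)"
        using G'(2) 1 by (simp add: G'v G0s H1 H2)
      moreover have "(?G(x := {#})) v = {#}" using 1 dis G0s[of v] by auto
      ultimately show ?thesis by simp
    next
      case 2
      then have "v \<notin> Fv M" using f1_vars f2_vars by blast
      moreover from this 2 have "v \<notin> Fv ?P"
        unfolding Fd FP2 set_fv_list by auto
      then have "G v = {#}" by (rule ty_support[OF GP])
      ultimately show ?thesis using G0s[of v] HN1 HN2 2 by simp
    next
      case 3
      then have "G v = (if v = x2 \<or> v = x1 then {#} else G0 v)"
        using G'(3) H1[OF x1] H1[of v] H2[of v] by (simp add: G'v)
      moreover have "v = x \<Longrightarrow> v = x1 \<or> v = x2 \<or> G0 v = {#}" using M' G0s by blast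
      ultimately show ?thesis using HN1 HN2 3 by auto
    qed
  qed
  ultimately show "\<exists>G1 H. ty G1 (Dup x x1 x2 M) \<sigma> \<and> msum (\<lambda>H \<tau>. ty H N \<tau>) H (G1 x) \<and> G = G1(x := {#}) + H"
    using m by metis
qed

lemma is_subst_alpha1s:
  fixes T :: "'p itself"
  assumes a: "alpha1s M M'" and M: "M \<in> LamR" and P: "is_subst T M' x N P"
  shows "is_subst T M x N P"
proof (rule is_substI)
  note inv = alpha1s_invariants[OF a M]
  have al: "alpha (Sub M x N) (Sub M' x N)"
    using equivclp_ctx[OF ctx_closed_intros(6)] alpha1s_imp_alpha[OF a] unfolding alpha_def by blast
  \<comment> \<open>\<open>esub\<close> allows alpha-conversion only as part of a step. The result
    contains no explicit substitution, so there is a first step to absorb the renaming of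
    \<open>M\<close>.\<close>
  have "Sub M' x N \<noteq> P" using is_substD(2)[OF P] LamR_iff(5) by blast
  then show "esub\<^sup>*\<^sup>* (Sub M x N) P"
    using is_substD(1)[OF P] alpha_esub[OF al]
    by (metis converse_rtranclpE converse_rtranclp_into_rtranclp)
  show "\<exists>G1 H. ty G1 M \<sigma> \<and> msum (\<lambda>H \<tau>. ty H N \<tau>) H (G1 x) \<and> G = G1(x := {#}) + H"
    if "ty G P \<sigma>" for G :: "'p env" and \<sigma>
    using is_subst_ty[OF P that] inv(5) by metis
qed (use is_substD[OF P] alpha1s_invariants[OF a M] in auto)

text \<open>Lexicographic induction on \<open>dup_count M x\<close> and the size of
  \<open>M\<close>. The rules that push the substitution inwards keep the count and decrease the
  size; a duplication of \<open>x\<close> itself decreases the count.\<close>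

lemma ex_is_subst:
  fixes T :: "'p itself"
  assumes "M \<in> LamR" "N \<in> LamR" "x \<in> Fv M" "(Fv M - {x}) \<inter> Fv N = {}"
  shows "\<exists>P. is_subst T M x N P"
  using assms
proof (induction "dup_count M x" arbitrary: M N x rule: less_induct)
  case less
  note outer = less.hyps
  from less.prems show ?case using outer
  \<comment> \<open>The inner induction keeps \<open>N\<close> and \<open>x\<close>. The outer one
    varies them, since a duplication of \<open>x\<close> replaces them by renamed copies of
    \<open>N\<close> and the bound names.\<close>
  proof (induction "size M" arbitrary: M rule: less_induct)
    case less
    note inner = less.hyps and outer = less.prems(5)
    note prems = less.prems(1-4)
    have inner': "\<exists>P. is_subst T M' x N P"
      if "size M' < size M" "dup_count M' x = dup_count M x" "M' \<in> LamR" "x \<in> Fv M'"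
        "(Fv M' - {x}) \<inter> Fv N = {}" for M'
      using inner[OF that(1,3) prems(2) that(4,5)] outer that(2) by simp
    from prems(1) show ?case
    proof (cases rule: LamR.cases)
      case (Var y)
      then show ?thesis using prems is_subst_Var by auto
    next
      case (Lam M0 y0)
      obtain y M1 where y: "y \<notin> insert x (Fv N)" "alpha1s M (Lam y M1)"
        using fresh_Lam[of "insert x (Fv N)" y0 M0] finite_Fv Lam(1) by auto
      note inv = alpha1s_invariants[OF y(2) prems(1)]
      have M1: "M1 \<in> LamR" using inv(1) by (auto simp: LamR_iff)
      have "\<exists>P. is_subst T M1 x N P"
      proof (rule inner')
        show "size M1 < size M" using inv(3) by simp
        show "dup_count M1 x = dup_count M x" using fun_cong[OF inv(4), of x] y by simp
      qed (use inv(2) M1 prems y(1) in auto)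
      then show ?thesis
        using is_subst_alpha1s[OF y(2) prems(1)] is_subst_Lam[OF _ inv(1)] y(1) by blast
    next
      case (App M0 Q)
      show ?thesis
      proof (cases "x \<in> Fv M0")
        case True
        then have "x \<notin> Fv Q" using App by auto
        then have "\<exists>P. is_subst T M0 x N P" "Fv Q \<inter> Fv N = {}"
          using True App prems by (auto intro!: inner' simp: dup_count_notin)
        then show ?thesis using is_subst_AppL[of T M0 x N _ Q] App True prems(1) by blast
      next
        case False
        then have "x \<in> Fv Q" using App prems by auto
        then have "\<exists>P. is_subst T Q x N P" "Fv M0 \<inter> Fv N = {}"
          using False App prems by (auto intro!: inner' simp: dup_count_notin)
        then show ?thesis using is_subst_AppR[of T Q x N _ M0] App \<open>x \<in> Fv Q\<close> prems(1) by blast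
      qed
    next
      case (Era M0 y)
      show ?thesis
      proof (cases "y = x")
        case True
        then show ?thesis using is_subst_Era_same[of N x M0 T] Era prems by auto
      next
        case False
        have "\<exists>P. is_subst T M0 x N P"
          by (rule inner') (use Era prems(3,4) False in auto)
        then show ?thesis using is_subst_Era[of T M0 x N _ y] Era False prems by auto
      qed
    next
      case (Dup M0 z1 z2 y)
      obtain y1 y2 M1 where y: "y1 \<notin> insert x (Fv N)" "y2 \<notin> insert x (Fv N)" "alpha1s M (Dup y y1 y2 M1)"
        using fresh_Dup[of "insert x (Fv N)" y z1 z2 M0] finite_Fv Dup(1) prems(1) by auto
      note inv = alpha1s_invariants[OF y(3) prems(1)]
      have M1: "M1 \<in> LamR" "y1 \<in> Fv M1" "y2 \<in> Fv M1" "y1 \<noteq> y2" "y \<notin> Fv M1 - {y1, y2}"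
        using inv(1) by (auto simp: LamR_iff)
      have FM: "Fv M = insert y (Fv M1 - {y1, y2})" using inv(2) by simp
      show ?thesis
      proof (cases "y = x")
        case False
        have "\<exists>P. is_subst T M1 x N P"
        proof (rule inner')
          show "size M1 < size M" using inv(3) by simp
          show "dup_count M1 x = dup_count M x" using fun_cong[OF inv(4), of x] y False by simp
          show "x \<in> Fv M1" using FM prems(3) False by auto
          show "(Fv M1 - {x}) \<inter> Fv N = {}" using FM prems(4) y(1,2) by auto
        qed (rule M1(1))
        moreover have "y \<notin> Fv N" using FM prems(4) False by auto
        ultimately show ?thesis
          using is_subst_alpha1s[OF y(3) prems(1)] is_subst_Dup[OF _ inv(1)] y False by blast
      next
        case True
        have dc: "dup_count M x = Suc (dup_count M1 y1 + dup_count M1 y2)"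
          using fun_cong[OF inv(4), of x] True by simp
        have dis: "(Fv M1 - {y1, y2}) \<inter> Fv N = {}" using FM prems(4) True M1(5) by auto
        let ?A = "vars M1 \<union> vars N \<union> {x, y1, y2}"
        have A: "finite ?A" "Fv N \<subseteq> ?A" using finite_vars Fv_subset_vars by auto
        obtain \<pi>1 where \<pi>1: "involution \<pi>1" "\<pi>1 ` Fv N \<inter> ?A = {}"
          "\<And>v. v \<in> ?A \<Longrightarrow> v \<notin> Fv N \<Longrightarrow> \<pi>1 v = v" using ex_fresh_involution[OF A] by metis
        have B: "finite (?A \<union> \<pi>1 ` Fv N)" "Fv N \<subseteq> ?A \<union> \<pi>1 ` Fv N" using A finite_Fv by auto
        obtain \<pi>2 where \<pi>2: "involution \<pi>2" "\<pi>2 ` Fv N \<inter> (?A \<union> \<pi>1 ` Fv N) = {}"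
          "\<And>v. v \<in> ?A \<union> \<pi>1 ` Fv N \<Longrightarrow> v \<notin> Fv N \<Longrightarrow> \<pi>2 v = v"
          using ex_fresh_involution[OF B] by metis
        have N: "rename \<pi>1 N \<in> LamR" "rename \<pi>2 N \<in> LamR" "Fv (rename \<pi>1 N) = \<pi>1 ` Fv N"
          "Fv (rename \<pi>2 N) = \<pi>2 ` Fv N"
          using \<pi>1(1) \<pi>2(1) prems(2) by (auto simp: rename_LamR Fv_rename)
        have V: "Fv M1 \<subseteq> vars M1" by (rule Fv_subset_vars)
        have "(Fv M1 - {y1}) \<inter> Fv (rename \<pi>1 N) = {}" using V \<pi>1(2) N(3) by blast
        then obtain P1 where P1: "is_subst T M1 y1 (rename \<pi>1 N) P1"
          using outer[of M1 y1 "rename \<pi>1 N"] dc M1 N by auto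
        have FP1: "Fv P1 = (Fv M1 - {y1}) \<union> \<pi>1 ` Fv N" using is_substD(3)[OF P1] N by simp
        \<comment> \<open>\<open>P1\<close> may be larger than \<open>M\<close>, but the copy
          substituted in it left the count of \<open>y2\<close> alone, so that count is still below
          \<open>dup_count M x\<close>.\<close>
        have "dup_count P1 y2 = dup_count M1 y2" using is_substD(4)[OF P1] M1 by auto
        moreover have "(Fv P1 - {y2}) \<inter> Fv (rename \<pi>2 N) = {}" using V \<pi>2(2) N(4) FP1 by blast
        moreover have "y2 \<in> Fv P1" using FP1 M1 by auto
        ultimately obtain P2 where P2: "is_subst T P1 y2 (rename \<pi>2 N) P2"
          using outer[of P1 y2 "rename \<pi>2 N"] dc N is_substD(2)[OF P1] by auto
        show ?thesis
          using is_subst_alpha1s[OF y(3)[unfolded True] prems(1)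
              is_subst_Dup_same[OF prems(2) inv(1)[unfolded True] dis \<pi>1(1,2) _ \<pi>2(1,2) _ P1 P2]]
            \<pi>1(3) \<pi>2(3) by auto
      qed
    qed
  qed
qed

section \<open>Reduction\<close>

primrec sub_free :: "trm \<Rightarrow> bool" where
  "sub_free (Var x) = True"
| "sub_free (Lam x M) = sub_free M"
| "sub_free (App M N) = (sub_free M \<and> sub_free N)"
| "sub_free (Era x M) = sub_free M"
| "sub_free (Dup x x1 x2 M) = sub_free M"
| "sub_free (Sub M x N) = False"

lemma LamR_sub_free: "M \<in> LamR \<Longrightarrow> sub_free M"
  by (induction rule: LamR.induct) auto

lemma sub_free_rename: "sub_free (rename f M) = sub_free M"
  by (induction M) auto

lemma ctx_alpha1_sub_free: "ctx alpha1 M N \<Longrightarrow> sub_free M = sub_free N"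
  by (induction rule: ctx.induct) (auto elim!: alpha1.cases simp: sub_free_rename)

lemma alpha_sub_free: "alpha M N \<Longrightarrow> sub_free M = sub_free N"
  unfolding alpha_def
  by (induction rule: equivclp_induct) (auto dest: ctx_alpha1_sub_free)

lemma ctx_esub1_not_sub_free: "ctx esub1 M N \<Longrightarrow> \<not> sub_free M"
  by (induction rule: ctx.induct) (auto elim: esub1.cases)

text \<open>\<open>alpha\<close> is an equivalence on all raw terms and may pass through terms
  outside \<open>LamR\<close>. The invariant used is therefore \<open>sub_free\<close>, and every
  redex of \<open>esub1\<close> violates it.\<close>

lemma LamR_esub_normal: "P \<in> LamR \<Longrightarrow> \<not> esub P Q"
  unfolding esub_def using LamR_sub_free alpha_sub_free ctx_esub1_not_sub_free by blast

lemma is_subst_imp_subst: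
  assumes "is_subst T M x N P" "M \<in> LamR" "N \<in> LamR" "x \<in> Fv M" "(Fv M - {x}) \<inter> Fv N = {}"
  shows "subst M N x P"
  using assms is_substD[OF assms(1)] LamR_esub_normal unfolding subst_def by blast

lemma struct_eq_refl: "struct_eq M M"
  by (simp add: struct_eq_def equivclp_refl)

lemma struct_eq_trans: "struct_eq M N \<Longrightarrow> struct_eq N P \<Longrightarrow> struct_eq M P"
  unfolding struct_eq_def by (rule equivclp_trans)

lemma struct1_imp_struct_eq: "struct1 M N \<Longrightarrow> struct_eq M N"
  unfolding struct_eq_def by (blast intro: r_into_equivclp ctx.base)

lemma alpha1s_imp_struct_eq: "alpha1s M N \<Longrightarrow> struct_eq M N"
proof (induction rule: rtranclp_induct)
  case (step P Q)
  then show ?case unfolding struct_eq_def by (blast intro: equivclp_into_equivclp ctx.base)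
qed (rule struct_eq_refl)

lemma struct_eq_ctx: "ctx_closed C \<Longrightarrow> struct_eq M N \<Longrightarrow> struct_eq (C M) (C N)"
  unfolding struct_eq_def by (rule equivclp_ctx)

lemma red_ctx: "ctx_closed C \<Longrightarrow> red M N \<Longrightarrow> red (C M) (C N)"
  unfolding red_def using struct_eq_ctx[of C] unfolding ctx_closed_def by blast

lemma red1_imp_red: "red1 M N \<Longrightarrow> red M N"
  unfolding red_def using struct_eq_refl by (blast intro: ctx.base)

lemma struct_eq_red: "struct_eq M N \<Longrightarrow> red N P \<Longrightarrow> red M P"
  unfolding red_def using struct_eq_trans by blast

text \<open>The step goes from \<open>M\<close> to \<open>M'\<close>, typings are carried from
  \<open>M'\<close> to \<open>M\<close>. Equality of free variables keeps the surrounding term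
  linear when the step happens inside it.\<close>

definition expandable :: "'p itself \<Rightarrow> trm \<Rightarrow> trm \<Rightarrow> bool" where
  "expandable T M M' \<longleftrightarrow> red M M' \<and> M' \<in> LamR \<and> Fv M' = Fv M \<and>
     (\<forall>(G :: 'p env) \<sigma>. ty G M' \<sigma> \<longrightarrow> ty G M \<sigma>)"

lemma expandableI:
  fixes T :: "'p itself"
  assumes "red M M'" "M' \<in> LamR" "Fv M' = Fv M" "\<And>(G :: 'p env) \<sigma>. ty G M' \<sigma> \<Longrightarrow> ty G M \<sigma>"
  shows "expandable T M M'"
  using assms unfolding expandable_def by blast

lemma expandableD:
  fixes T :: "'p itself"
  assumes "expandable T M M'"
  shows "red M M'" "M' \<in> LamR" "Fv M' = Fv M" "ty (G :: 'p env) M' \<sigma> \<Longrightarrow> ty G M \<sigma>"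
  using assms unfolding expandable_def by blast+

lemma expandable_AppL:
  fixes T :: "'p itself"
  assumes "expandable T M M'" "App M N \<in> LamR"
  shows "expandable T (App M N) (App M' N)"
proof (rule expandableI)
  note e = expandableD[OF assms(1)]
  show "red (App M N) (App M' N)" using red_ctx[OF ctx_closed_intros(2) e(1)] .
  show "App M' N \<in> LamR" using assms(2) e by (auto simp: LamR_iff)
  show "Fv (App M' N) = Fv (App M N)" using e by simp
  show "ty G (App M N) \<sigma>" if "ty G (App M' N) \<sigma>" for G :: "'p env" and \<sigma>
    using that e(4) by (auto elim!: ty_AppE intro: ty.App)
qed

lemma expandable_Dup:
  fixes T :: "'p itself"
  assumes "expandable T M M'" "Dup x x1 x2 M \<in> LamR"
  shows "expandable T (Dup x x1 x2 M) (Dup x x1 x2 M')"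
proof (rule expandableI)
  note e = expandableD[OF assms(1)]
  show "red (Dup x x1 x2 M) (Dup x x1 x2 M')" using red_ctx[OF ctx_closed_intros(5) e(1)] .
  show "Dup x x1 x2 M' \<in> LamR" using assms(2) e by (auto simp: LamR_iff)
  show "Fv (Dup x x1 x2 M') = Fv (Dup x x1 x2 M)" using e by simp
  show "ty G (Dup x x1 x2 M) \<sigma>" if "ty G (Dup x x1 x2 M') \<sigma>" for G :: "'p env" and \<sigma>
    using that e(4) by (auto elim!: ty_DupE intro: ty.Dup)
qed

text \<open>Splitting the typing of the reduct gives exactly the premises of an application. The
  assumed typing of \<open>N\<close> serves when the type of \<open>x\<close> is empty and no other
  typing of \<open>N\<close> is at hand.\<close>

lemma ex_expandable_beta:
  fixes T :: "'p itself"
  assumes M: "App (Lam x M) N \<in> LamR" and N: "ty (G0 :: 'p env) N \<tau>0"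
  shows "\<exists>P. expandable T (App (Lam x M) N) P"
proof -
  have L: "Lam x M \<in> LamR" and M': "N \<in> LamR" "(Fv M - {x}) \<inter> Fv N = {}"
    using M by (auto simp: LamR_iff)
  have L': "M \<in> LamR" "x \<in> Fv M" using L by (auto simp: LamR_iff)
  obtain P where P: "is_subst T M x N P" using ex_is_subst[OF L'(1) M'(1) L'(2) M'(2)] by blast
  have "expandable T (App (Lam x M) N) P"
  proof (rule expandableI)
    show "red (App (Lam x M) N) P"
      using is_subst_imp_subst[OF P L'(1) M'(1) L'(2) M'(2)] by (intro red1_imp_red red1.beta)
    show "P \<in> LamR" "Fv P = Fv (App (Lam x M) N)" using is_substD[OF P] by auto
    fix G :: "'p env" and \<sigma> assume "ty G P \<sigma>"
    from is_subst_ty[OF P this]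
    obtain G1 H where *: "ty G1 M \<sigma>" "msum (\<lambda>H \<tau>. ty H N \<tau>) H (G1 x)" "G = G1(x := {#}) + H" .
    show "ty G (App (Lam x M) N) \<sigma>" unfolding *(3) using ty.Lam[OF *(1)] *(2) N by (rule ty.App)
  qed
  then show ?thesis ..
qed

lemma expandable_omega2:
  fixes T :: "'p itself"
  assumes M: "App (Era x M) N \<in> LamR"
  shows "expandable T (App (Era x M) N) (Era x (App M N))"
proof (rule expandableI)
  have E: "Era x M \<in> LamR" and M': "N \<in> LamR" "x \<notin> Fv N" "Fv M \<inter> Fv N = {}"
    using M by (auto simp: LamR_iff)
  have E': "M \<in> LamR" "x \<notin> Fv M" using E by (auto simp: LamR_iff)
  show "red (App (Era x M) N) (Era x (App M N))" by (intro red1_imp_red red1.omega2)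
  show "Era x (App M N) \<in> LamR" using M' E' by (auto simp: LamR_iff)
  show "ty G (App (Era x M) N) \<sigma>" if "ty G (Era x (App M N)) \<sigma>" for G :: "'p env" and \<sigma>
    using that by (auto elim!: ty_EraE ty_AppE intro: ty.App ty.Era)
qed simp

text \<open>\<open>red\<close> absorbs a structural step in front, so a redex may first be brought
  into the form its rule expects.\<close>

lemma struct_eq_expandable:
  fixes T :: "'p itself"
  assumes "struct_eq M N" "Fv N = Fv M" "\<And>(G :: 'p env) \<sigma>. ty G N \<sigma> \<Longrightarrow> ty G M \<sigma>" "expandable T N P"
  shows "expandable T M P"
  using assms struct_eq_red expandableD[OF assms(4)] by (intro expandableI) auto

lemma ex_expandable_gamma1:
  fixes T :: "'p itself"
  assumes M: "Dup x x1 x2 (Lam y0 M0) \<in> LamR"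
  shows "\<exists>P. expandable T (Dup x x1 x2 (Lam y0 M0)) P"
proof -
  have L0: "Lam y0 M0 \<in> LamR" using M by (auto simp: LamR_iff)
  \<comment> \<open>A clash is possible with \<open>x\<close> only, as \<open>x1\<close> and
    \<open>x2\<close> are free in the abstraction; the new name has to avoid all three.\<close>
  obtain y M where y: "y \<notin> {x, x1, x2}" "alpha1s (Lam y0 M0) (Lam y M)"
    using fresh_Lam[of "{x, x1, x2}" y0 M0] by auto
  note inv = alpha1s_invariants[OF y(2) L0]
  have L: "M \<in> LamR" "y \<in> Fv M" using inv(1) by (auto simp: LamR_iff)
  have D: "x1 \<noteq> x2" "x1 \<in> Fv (Lam y M)" "x2 \<in> Fv (Lam y M)" "x \<notin> Fv (Lam y M) - {x1, x2}"
    unfolding inv(2) using M by (auto simp: LamR_iff)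
  have "expandable T (Dup x x1 x2 (Lam y M)) (Lam y (Dup x x1 x2 M))"
  proof (rule expandableI)
    show "red (Dup x x1 x2 (Lam y M)) (Lam y (Dup x x1 x2 M))"
      using y(1) by (intro red1_imp_red red1.gamma1)
    show "Lam y (Dup x x1 x2 M) \<in> LamR" using L D y(1) by (auto simp: LamR_iff)
    show "Fv (Lam y (Dup x x1 x2 M)) = Fv (Dup x x1 x2 (Lam y M))" using y(1) by auto
    fix G :: "'p env" and \<sigma> assume "ty G (Lam y (Dup x x1 x2 M)) \<sigma>"
    then obtain K \<tau> where K: "G = K(y := {#})" "\<sigma> = Arr (K y) \<tau>" "ty K (Dup x x1 x2 M) \<tau>"
      by (auto elim: ty_LamE)
    then obtain H where H: "K = H(x1 := {#}, x2 := {#}, x := H x1 + H x2)" "ty H M \<tau>"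
      by (auto elim: ty_DupE)
    let ?H = "H(y := {#})"
    have "K y = H y" using y(1) H(1) by auto
    then have t: "ty ?H (Lam y M) \<sigma>" using ty.Lam[OF H(2), of y] K(2) by simp
    have eq: "G = ?H(x1 := {#}, x2 := {#}, x := ?H x1 + ?H x2)"
      using y(1) H(1) K(1) by (auto simp: fun_eq_iff)
    show "ty G (Dup x x1 x2 (Lam y M)) \<sigma>" by (subst eq) (rule ty.Dup[OF t])
  qed
  moreover have "struct_eq (Dup x x1 x2 (Lam y0 M0)) (Dup x x1 x2 (Lam y M))"
    by (rule struct_eq_ctx[OF ctx_closed_intros(5) alpha1s_imp_struct_eq[OF y(2)]])
  moreover have "Fv (Dup x x1 x2 (Lam y M)) = Fv (Dup x x1 x2 (Lam y0 M0))"
    using inv(2) by simp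
  moreover have "ty G (Dup x x1 x2 (Lam y0 M0)) \<sigma>" if "ty G (Dup x x1 x2 (Lam y M)) \<sigma>"
    for G :: "'p env" and \<sigma>
    using that inv(5) by (auto elim!: ty_DupE intro: ty.Dup)
  ultimately show ?thesis using struct_eq_expandable by blast
qed

text \<open>Each element of \<open>\<alpha>\<close> is assigned by an axiom, and the axiom bases add
  up at \<open>x\<close>.\<close>

lemma msum_Var: "msum (\<lambda>H \<tau>. ty H (Var x) \<tau>) H \<alpha> \<Longrightarrow> H = 0(x := \<alpha>)"
proof (induction rule: msum.induct)
  case (add G \<tau> H \<alpha>)
  then have "G = 0(x := {#\<tau>#})" by (auto elim: ty_VarE)
  with add show ?case by (auto simp: fun_eq_iff)
qed (auto simp: fun_eq_iff)

text \<open>The erased copy has the empty type, so the sum of both types is the type of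
  \<open>x2\<close>, which substituting \<open>Var x\<close> transfers to \<open>x\<close>.\<close>

lemma ex_expandable_gammaomega2:
  fixes T :: "'p itself"
  assumes M: "Dup x x1 x2 (Era x1 M) \<in> LamR"
  shows "\<exists>P. expandable T (Dup x x1 x2 (Era x1 M)) P"
proof -
  have E: "Era x1 M \<in> LamR" and D: "x1 \<noteq> x2" "x2 \<in> Fv M" "x \<notin> Fv M - {x1, x2}"
    using M by (auto simp: LamR_iff)
  have E': "M \<in> LamR" "x1 \<notin> Fv M" using E by (auto simp: LamR_iff)
  have V: "Var x \<in> LamR" "(Fv M - {x2}) \<inter> Fv (Var x) = {}"
    using D E' by (auto simp: LamR_iff LamR.Var)
  obtain P where P: "is_subst T M x2 (Var x) P" using ex_is_subst[OF E'(1) V(1) D(2) V(2)] by blast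
  have "expandable T (Dup x x1 x2 (Era x1 M)) P"
  proof (rule expandableI)
    show "red (Dup x x1 x2 (Era x1 M)) P"
      using is_subst_imp_subst[OF P E'(1) V(1) D(2) V(2)]
      by (intro red1_imp_red red1.gammaomega2)
    show "P \<in> LamR" "Fv P = Fv (Dup x x1 x2 (Era x1 M))" using is_substD[OF P] E'(2) by auto
    fix G :: "'p env" and \<sigma> assume "ty G P \<sigma>"
    from is_subst_ty[OF P this]
    obtain G1 H where *: "ty G1 M \<sigma>" "msum (\<lambda>H \<tau>. ty H (Var x) \<tau>) H (G1 x2)" "G = G1(x2 := {#}) + H" .
    have H: "H = 0(x := G1 x2)" using msum_Var[OF *(2)] .
    have x1: "G1 x1 = {#}" using ty_support[OF *(1) E'(2)] .
    have x: "x = x2 \<or> G1 x = {#}" using ty_support[OF *(1), of x] D E'(2) by blast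
    have eq: "G = G1(x1 := {#}, x2 := {#}, x := G1 x1 + G1 x2)"
      using x1 x unfolding *(3) H by (auto simp: fun_eq_iff)
    show "ty G (Dup x x1 x2 (Era x1 M)) \<sigma>" by (subst eq) (rule ty.Dup[OF ty.Era[OF *(1)]])
  qed
  then show ?thesis ..
qed

lemma expandable_gammaomega1:
  fixes T :: "'p itself"
  assumes M: "Dup x x1 x2 (Era y M) \<in> LamR" and y: "y \<noteq> x1" "y \<noteq> x2"
  shows "expandable T (Dup x x1 x2 (Era y M)) (Era y (Dup x x1 x2 M))"
proof (rule expandableI)
  have E: "Era y M \<in> LamR" and D: "x1 \<noteq> x2" "x1 \<in> Fv M" "x2 \<in> Fv M" "x \<notin> Fv M - {x1, x2}" "x \<noteq> y"
    using M y by (auto simp: LamR_iff)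
  have E': "M \<in> LamR" "y \<notin> Fv M" using E by (auto simp: LamR_iff)
  show "red (Dup x x1 x2 (Era y M)) (Era y (Dup x x1 x2 M))"
    using y by (intro red1_imp_red red1.gammaomega1)
  show "Era y (Dup x x1 x2 M) \<in> LamR" using E' D by (auto simp: LamR_iff)
  show "Fv (Era y (Dup x x1 x2 M)) = Fv (Dup x x1 x2 (Era y M))" using y by auto
  show "ty G (Dup x x1 x2 (Era y M)) \<sigma>" if "ty G (Era y (Dup x x1 x2 M)) \<sigma>" for G :: "'p env" and \<sigma>
    using that by (auto elim!: ty_EraE ty_DupE intro: ty.Dup ty.Era)
qed

lemma ex_expandable_Dup_Era:
  fixes T :: "'p itself"
  assumes M: "Dup x x1 x2 (Era y M) \<in> LamR"
  shows "\<exists>P. expandable T (Dup x x1 x2 (Era y M)) P"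
proof -
  consider "y = x1" | "y = x2" | "y \<noteq> x1" "y \<noteq> x2" by blast
  then show ?thesis
  proof cases
    case 1
    then show ?thesis using M ex_expandable_gammaomega2 by blast
  next
    case 2
    have D: "Era y M \<in> LamR" "x1 \<noteq> x2" "x1 \<in> Fv (Era y M)" "x2 \<in> Fv (Era y M)"
      "x \<notin> Fv (Era y M) - {x1, x2}"
      using M by (auto simp: LamR_iff)
    \<comment> \<open>The reduction rule erases the first copy only. Exchanging the copies is a
      structural step, harmless for types because the sum is commutative.\<close>
    have "Dup x x2 x1 (Era y M) \<in> LamR"
      using D by (intro LamR.Dup) auto
    then obtain P where P: "expandable T (Dup x x2 x1 (Era y M)) P"
      using ex_expandable_gammaomega2 2 by blast
    have "expandable T (Dup x x1 x2 (Era y M)) P"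
    proof (rule struct_eq_expandable[OF _ _ _ P])
      show "struct_eq (Dup x x1 x2 (Era y M)) (Dup x x2 x1 (Era y M))"
        by (intro struct1_imp_struct_eq struct1.intros)
      fix G :: "'p env" and \<sigma> assume "ty G (Dup x x2 x1 (Era y M)) \<sigma>"
      then obtain H where H: "G = H(x2 := {#}, x1 := {#}, x := H x2 + H x1)" "ty H (Era y M) \<sigma>"
        by (auto elim: ty_DupE)
      have eq: "G = H(x1 := {#}, x2 := {#}, x := H x1 + H x2)"
        unfolding H(1) using D(2) by (auto simp: fun_eq_iff add.commute)
      show "ty G (Dup x x1 x2 (Era y M)) \<sigma>" by (subst eq) (rule ty.Dup[OF H(2)])
    qed auto
    then show ?thesis ..
  next
    case 3
    then show ?thesis using expandable_gammaomega1[OF M] by blast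
  qed
qed

section \<open>Heads of applications\<close>

primrec spine_args :: "trm \<Rightarrow> trm set" where
  "spine_args (Var x) = {}"
| "spine_args (Lam x M) = {}"
| "spine_args (App M N) = insert N (spine_args M)"
| "spine_args (Era x M) = {}"
| "spine_args (Dup x x1 x2 M) = spine_args M"
| "spine_args (Sub M x N) = {}"

text \<open>An abstraction or erasure at the root settles nothing by itself, so both stay as
  separate outcomes. They are resolved one level up, where the enclosing application or duplication
  turns them into a redex.\<close>

lemma head_cases:
  fixes T :: "'p itself"
  assumes "M \<in> LamR" "\<forall>Q \<in> spine_args M. \<exists>(G :: 'p env) \<tau>. ty G Q \<tau>"
  shows "(\<forall>\<sigma>. \<exists>G :: 'p env. ty G M \<sigma>) \<or> (\<exists>x P. M = Lam x P) \<or> (\<exists>x P. M = Era x P) \<or>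
    (\<exists>M'. expandable T M M')"
  using assms
proof (induction rule: LamR.induct)
  case (Var x)
  then show ?case using ty.Var by blast
next
  case (App M N)
  have L: "App M N \<in> LamR" using App.hyps by (rule LamR.App)
  obtain G0 :: "'p env" and \<tau>0 where N: "ty G0 N \<tau>0" using App.prems by auto
  from App consider "\<forall>\<sigma>. \<exists>G :: 'p env. ty G M \<sigma>" | x P where "M = Lam x P" | x P where "M = Era x P"
    | M' where "expandable T M M'" by fastforce
  then show ?case
  proof cases
    case 1
    have "\<exists>G :: 'p env. ty G (App M N) \<sigma>" for \<sigma>
    proof -
      \<comment> \<open>A function that can be given every type is given one with empty domain. No
        particular type is then asked of \<open>N\<close>; its being typeable is enough.\<close>
      obtain G :: "'p env" where "ty G M (Arr {#} \<sigma>)" using 1 by blast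
      from ty.App[OF this msum.empty N] show ?thesis by blast
    qed
    then show ?thesis by blast
  next
    case 2
    then show ?thesis using ex_expandable_beta[OF _ N] L by blast
  next
    case 3
    then show ?thesis using expandable_omega2 L by blast
  next
    case 4
    then show ?thesis using expandable_AppL L by blast
  qed
next
  case (Dup M x1 x2 x)
  have L: "Dup x x1 x2 M \<in> LamR" using Dup.hyps by (rule LamR.Dup)
  from Dup consider "\<forall>\<sigma>. \<exists>G :: 'p env. ty G M \<sigma>" | y P where "M = Lam y P" | y P where "M = Era y P"
    | M' where "expandable T M M'" by fastforce
  then show ?case
  proof cases
    case 1
    then show ?thesis using ty.Dup by blast
  next
    case 2
    then show ?thesis using ex_expandable_gamma1 L by blast
  next
    case 3
    then show ?thesis using ex_expandable_Dup_Era L by blast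
  next
    case 4
    then show ?thesis using expandable_Dup L by blast
  qed
qed blast+

section \<open>Strongly normalising terms\<close>

inductive subterm :: "trm \<Rightarrow> trm \<Rightarrow> bool" for N where
  refl: "subterm N N"
| Lam: "subterm N M \<Longrightarrow> subterm N (Lam x M)"
| AppL: "subterm N M \<Longrightarrow> subterm N (App M P)"
| AppR: "subterm N M \<Longrightarrow> subterm N (App P M)"
| Era: "subterm N M \<Longrightarrow> subterm N (Era x M)"
| Dup: "subterm N M \<Longrightarrow> subterm N (Dup x x1 x2 M)"

lemma subterm_trans: "subterm N M \<Longrightarrow> subterm P N \<Longrightarrow> subterm P M"
  by (induction rule: subterm.induct) (auto intro: subterm.intros)

lemma subterm_red: "subterm N M \<Longrightarrow> red N N' \<Longrightarrow> \<exists>M'. red M M' \<and> subterm N' M'"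
proof (induction rule: subterm.induct)
  case refl
  then show ?case using subterm.refl by blast
next
  case (Lam M x)
  then show ?case using red_ctx[OF ctx_closed_intros(1)] subterm.Lam by blast
next
  case (AppL M P)
  then show ?case using red_ctx[OF ctx_closed_intros(2)] subterm.AppL by blast
next
  case (AppR M P)
  then show ?case using red_ctx[OF ctx_closed_intros(3)] subterm.AppR by blast
next
  case (Era M x)
  then show ?case using red_ctx[OF ctx_closed_intros(4)] subterm.Era by blast
next
  case (Dup M x x1 x2)
  then show ?case using red_ctx[OF ctx_closed_intros(5)] subterm.Dup by blast
qed

lemma spine_args_subterm: "Q \<in> spine_args M \<Longrightarrow> subterm Q M \<and> size Q < size M"
  by (induction M) (auto intro: subterm.intros)

lemma spine_args_LamR: "M \<in> LamR \<Longrightarrow> Q \<in> spine_args M \<Longrightarrow> Q \<in> LamR"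
  by (induction rule: LamR.induct) auto

text \<open>Outside the accessible part every term has a reduct outside it as well, and iterating a
  choice of such reducts would give an infinite reduction.\<close>

lemma strongly_normalising_accp:
  assumes "strongly_normalising M"
  shows "Wellfounded.accp (\<lambda>N M. red M N) M" (is "?acc M")
proof (rule ccontr)
  assume M: "\<not> ?acc M"
  have "\<exists>N'. red N N' \<and> \<not> ?acc N'" if "\<not> ?acc N" for N
    using not_accp_down[OF that] by metis
  then obtain g where g: "\<And>N. \<not> ?acc N \<Longrightarrow> red N (g N) \<and> \<not> ?acc (g N)" by metis
  have "\<not> ?acc ((g ^^ i) M)" for i
    by (induction i) (use M g in auto)
  then have "\<exists>f. f 0 = M \<and> (\<forall>i. red (f i) (f (Suc i)))"
    using g by (intro exI[of _ "\<lambda>i. (g ^^ i) M"]) simp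
  then show False using assms unfolding strongly_normalising_def by blast
qed

text \<open>The outer induction runs over the accessible term \<open>M\<close>, the inner one over
  the size of a subterm \<open>N\<close>. Keeping \<open>M\<close> in the statement covers both
  proper subterms of \<open>N\<close> and reducts of \<open>N\<close>.\<close>

lemma subterm_typeable:
  fixes T :: "'p itself"
  assumes "Wellfounded.accp (\<lambda>N M. red M N) M" "subterm N M" "N \<in> LamR"
  shows "\<exists>(G :: 'p env) \<sigma>. ty G N \<sigma>"
  using assms
proof (induction arbitrary: N rule: accp_induct_rule)
  case (1 M)
  note outer = 1(2)
  from 1(3,4) show ?case
  proof (induction "size N" arbitrary: N rule: less_induct)
    case less
    have inner: "\<exists>(G :: 'p env) \<sigma>. ty G Q \<sigma>" if "subterm Q N" "size Q < size N" "Q \<in> LamR" for Q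
      using less.hyps[OF that(2) subterm_trans[OF less.prems(1) that(1)] that(3)] .
    from \<open>N \<in> LamR\<close> show ?case
    proof (cases rule: LamR.cases)
      case (Var x)
      then show ?thesis using ty.Var by blast
    next
      case (Lam P x)
      then show ?thesis using inner[of P] ty.Lam by (force intro: subterm.intros)
    next
      case (App P Q)
      have "\<forall>Q \<in> spine_args N. \<exists>(G :: 'p env) \<tau>. ty G Q \<tau>"
        using inner spine_args_subterm spine_args_LamR less.prems(2) by blast
      \<comment> \<open>An application is neither an abstraction nor an erasure, which leaves two
        outcomes.\<close>
      with less.prems(2) App(1) consider "\<forall>\<sigma>. \<exists>G :: 'p env. ty G N \<sigma>" | N' where "expandable T N N'"
        using head_cases[of N T] by auto
      then show ?thesis
      proof cases
        case 2
        \<comment> \<open>\<open>N'\<close> may be larger than \<open>N\<close>, but it sits inside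
          a reduct of \<open>M\<close>, where the outer hypothesis applies.\<close>
        obtain M' where "red M M'" "subterm N' M'"
          using subterm_red[OF less.prems(1) expandableD(1)[OF 2]] by blast
        then obtain G :: "'p env" and \<sigma> where "ty G N' \<sigma>" using outer expandableD(2)[OF 2] by blast
        then show ?thesis using expandableD(4)[OF 2] by blast
      qed blast
    next
      case (Era P x)
      then show ?thesis using inner[of P] ty.Era by (force intro: subterm.intros)
    next
      case (Dup P x1 x2 x)
      then show ?thesis using inner[of P] ty.Dup by (force intro: subterm.intros)
    qed
  qed
qed

theorem mainTheorem2:
  fixes M :: trm
  assumes "M \<in> LamR"
    and "strongly_normalising M"
  shows "\<exists>(\<Gamma> :: 'p basis) (\<sigma> :: 'p sty). finite (dom \<Gamma>) \<and> typing \<Gamma> M \<sigma>"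
proof -
  obtain G :: "'p env" and \<sigma> where "ty G M \<sigma>"
    using subterm_typeable[OF strongly_normalising_accp[OF assms(2)] subterm.refl assms(1)] by blast
  from ty_imp_typing[OF assms(1) this] show ?thesis
    using dom_to_basis[of "Fv M" G] finite_Fv[of M] by metis
qed

end
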